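(* For every integer $m$ let $P(m,a,b)$ and $Q(m,a,b)$ be the unique rational functions in $\mathbb{C}(a,b)$ such that $$ {}_2F_1\!\left(\left.{a+m,\;b \atop a-b}\right| -1\right)= P(m,a,b)\,\frac{\Gamma(a-b)\,\Gamma(\frac{a+1}{2})}{\Gamma(a)\,\Gamma(\frac{a+1}{2}-b)}+Q(m,a,b)\,\frac{\Gamma(a-b)\,\Gamma(\frac{a}{2})}{\Gamma(a)\,\Gamma(\frac{a}{2}-b)} $$ as an identity of meromorphic functions of $(a,b)\in\mathbb{C}^2$. If $n$ is a non-negative integer and $a,b\in\mathbb{C}$ satisfy $a,b\notin\{0,1,\ldots,n\}$, then $$ P(-n-1,\,a,\,b)=2^{2n}\,\frac{(1-\frac a2)_n}{(1-b)_n}\;P(n-1,\,a-2n,\,b-n), $$ $$ Q(-n-1,\,a,\,b)=-2^{2n}\,\frac{(\frac{1-a}{2})_n}{(1-b)_n}\;Q(n-1,\,a-2n,\,b-n). $$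
   Context: Notation: $(x)_k=x(x+1)\cdots(x+k-1)$ for $k\ge 0$, with $(x)_0=1$. ${}_2F_1\!\left(\left.{A,B\atop C}\right|z\right)$, for $C\notin\{0,-1,-2,\dots\}$, denotes the analytic continuation to $\mathbb{C}\setminus[1,\infty)$ of the hypergeometric series $\sum_{k\ge0}\frac{(A)_k(B)_k}{(C)_k\,k!}z^k$. Existence of the rational functions $P(m,a,b)$, $Q(m,a,b)$ for every integer $m$ follows from Gauss' contiguity relations and Kummer's identity ${}_2F_1\!\left(\left.{a,b\atop 1+a-b}\right|-1\right)=\frac{\Gamma(1+a-b)\Gamma(1+\frac a2)}{\Gamma(1+a)\Gamma(1+\frac a2-b)}$; uniqueness holds because the quotient of the two Gamma-terms is not in $\mathbb{C}(a,b)$. For example $P(-1,a,b)=1$, $Q(-1,a,b)=0$, $P(0,a,b)=Q(0,a,b)=\frac12$. Each right-hand side is regarded as a single rational function of $(a,b)$ (common factors of numerator and denominator cancelled) and evaluated at the given point. *)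

theory Defs
  imports "HOL-Complex_Analysis.Complex_Analysis"
    "HOL-Computational_Algebra.Computational_Algebra"
    "HOL-Computational_Algebra.Field_as_Ring"
begin

(* The analytic continuation of the hypergeometric series to the plane slit along [1, infinity).
   It is determined by the condition below on the slit plane only; values on the slit are
   arbitrary.  Meaningful for C outside the nonpositive integers. *)
definition hyp2F1 :: "complex \<Rightarrow> complex \<Rightarrow> complex \<Rightarrow> complex \<Rightarrow> complex" where
  "hyp2F1 A B C = (SOME F. F holomorphic_on (- complex_of_real ` {1..}) \<and>
     (\<forall>z\<in>ball 0 1. F z = eval_fps (fps_hypergeo [A, B] [C] 1) z))"

(* The field C(a,b): in "complex poly poly", the inner variable is a and the outer one is b. *)
type_synonym ratfun = "complex poly poly fract"

definition ratfun_const :: "complex \<Rightarrow> ratfun" where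
  "ratfun_const c = to_fract [:[:c:]:]"

definition ratfun_a :: ratfun where
  "ratfun_a = to_fract [:[:0, 1:]:]"

definition ratfun_b :: ratfun where
  "ratfun_b = to_fract [:0, 1:]"

(* p(x, y) for x, y in an extension field of the complex numbers, with embedding h. *)
definition poly2_at :: "(complex \<Rightarrow> 'k::field) \<Rightarrow> complex poly poly \<Rightarrow> 'k \<Rightarrow> 'k \<Rightarrow> 'k" where
  "poly2_at h p x y = poly (map_poly (\<lambda>c. poly (map_poly h c) x) p) y"

(* quot_of_fract yields the numerator and denominator in lowest terms. *)
definition ratfun_at :: "(complex \<Rightarrow> 'k::field) \<Rightarrow> ratfun \<Rightarrow> 'k \<Rightarrow> 'k \<Rightarrow> 'k" where
  "ratfun_at h r x y =
     poly2_at h (fst (quot_of_fract r)) x y / poly2_at h (snd (quot_of_fract r)) x y"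

definition ratfun_eval :: "ratfun \<Rightarrow> complex \<Rightarrow> complex \<Rightarrow> complex" where
  "ratfun_eval r a b = ratfun_at id r a b"

definition ratfun_regular :: "ratfun \<Rightarrow> complex \<Rightarrow> complex \<Rightarrow> bool" where
  "ratfun_regular r a b \<longleftrightarrow> poly2_at id (snd (quot_of_fract r)) a b \<noteq> 0"

(* The rational function r(x, y), for x, y themselves in C(a,b). *)
definition ratfun_subst :: "ratfun \<Rightarrow> ratfun \<Rightarrow> ratfun \<Rightarrow> ratfun" where
  "ratfun_subst r x y = ratfun_at ratfun_const r x y"

(* Equality of values at a point includes that both values exist; otherwise the convention
   x / 0 = 0 would also identify values at poles. *)
definition ratfun_eq_at :: "ratfun \<Rightarrow> ratfun \<Rightarrow> complex \<Rightarrow> complex \<Rightarrow> bool" where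
  "ratfun_eq_at r s a b \<longleftrightarrow>
     ratfun_regular r a b \<and> ratfun_regular s a b \<and> ratfun_eval r a b = ratfun_eval s a b"

(* The identity of meromorphic functions on C^2, stated on the dense connected open set where
   the hypergeometric function, the Gamma factors and both coefficients are holomorphic:
   excluding nonpositive integers a excludes the poles of Gamma ((a + 1) / 2), Gamma (a / 2) and
   Gamma a.  The remaining denominators Gamma ((a + 1) / 2 - b) and Gamma (a / 2 - b) need no
   condition: at a pole, Gamma is 0 by convention, so the quotient is 0, the value of the
   entire function 1 / Gamma. *)
definition kummer_decomposition :: "int \<Rightarrow> ratfun \<Rightarrow> ratfun \<Rightarrow> bool" where
  "kummer_decomposition m p q \<longleftrightarrow>
     (\<forall>a b. a \<notin> \<int>\<^sub>\<le>\<^sub>0 \<longrightarrow> a - b \<notin> \<int>\<^sub>\<le>\<^sub>0 \<longrightarrow> ratfun_regular p a b \<longrightarrow> ratfun_regular q a b \<longrightarrow>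
        hyp2F1 (a + of_int m) b (a - b) (-1) =
          ratfun_eval p a b * (Gamma (a - b) * Gamma ((a + 1) / 2) / (Gamma a * Gamma ((a + 1) / 2 - b))) +
          ratfun_eval q a b * (Gamma (a - b) * Gamma (a / 2) / (Gamma a * Gamma (a / 2 - b))))"

definition kummer_PQ :: "int \<Rightarrow> ratfun \<times> ratfun" where
  "kummer_PQ m = (THE (p, q). kummer_decomposition m p q)"

definition kummer_P :: "int \<Rightarrow> ratfun" where
  "kummer_P m = fst (kummer_PQ m)"

definition kummer_Q :: "int \<Rightarrow> ratfun" where
  "kummer_Q m = snd (kummer_PQ m)"

end

theory Submission
  imports Defs
begin

text \<open>
  Both sides come from one three-term recurrence.  For fixed \<open>a, b\<close>, Gauss' contiguity relation in the
  first parameter expresses \<open>F(a-n-3, b; a-b; -1)\<close> through its two predecessors, and the hypergeometric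
  differential equation at \<open>z = -1\<close> does the same for the diagonal sequence \<open>F(a-n-1, b-n; a-b-n; -1)\<close>,
  which is the function belonging to \<open>m = n - 1\<close> at the point \<open>(a - 2n, b - n)\<close>.  After clearing
  \<open>(1-b)_n\<close> in the first case and \<open>(-1)^n \<Gamma>(a-b-n)\<close> in the second, the two recurrences are identical,
  so the same polynomials \<open>N_n, M_n\<close> are, up to explicit factors, the numerators of \<open>P(-n-1, a, b)\<close> and
  \<open>P(n-1, a-2n, b-n)\<close>, respectively of the two \<open>Q\<close>.  The initial values are Kummer's identity and a
  contiguous variant of it.

  The analytic continuation exists by Euler's integral when the real parts of \<open>B\<close> and \<open>C - B\<close> exceed 1;
  first-order differential operators lower \<open>B\<close> and \<open>C\<close> from there.  Kummer's identity follows from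
  contiguity relations that shift \<open>a\<close> by 2 and \<open>b\<close> by 1: for negative real part of \<open>b\<close> let \<open>a\<close> tend to infinity
  along the first shift, and then use the second one.
\<close>

section \<open>Analytic continuation of the hypergeometric series\<close>

text \<open>The point -1 lies on the boundary of the disc of convergence, where the series may
  diverge, so contiguity relations are proved as power series identities at 0 and carried to -1 by
  the identity theorem. Existence of the continuation, hidden in the choice operator of
  \<open>hyp2F1\<close>, is therefore the first obstacle. The minus sign in the identity for Q comes
  from the seeds: in units of the two Gamma quotients, the cleared first sequence starts with 1, 2-a
  and 0, a-1, the cleared diagonal one with 1, 2-a and 0, -(a-1). \<open>kummer_P\<close> and
  \<open>kummer_Q\<close> are definite descriptions, so explicit fractions must satisfy the
  decomposition at every point where their reduced forms are regular, and must be the only such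
  pair. For m = -n-1 a zero of (1-b)_n might disappear by cancellation, while F is known only after
  multiplication by (1-b)_n; excluding this is the algebraic core. Afterwards the two sides of each
  identity are one and the same element of C(a,b), and the claim at a point is that this element is
  regular there.\<close>

abbreviation slit_plane :: "complex set" where
  "slit_plane \<equiv> - complex_of_real ` {1..}"

abbreviation hyper_fps :: "complex \<Rightarrow> complex \<Rightarrow> complex \<Rightarrow> complex fps" where
  "hyper_fps A B C \<equiv> fps_hypergeo [A, B] [C] 1"

lemma open_slit_plane: "open slit_plane"
  by (intro open_Compl closed_slot_right)

lemma connected_slit_plane: "connected slit_plane"
  by (intro starlike_imp_connected starlike_slotted_complex_plane_right)

lemma minus_one_in_slit_plane: "-1 \<in> slit_plane"
  by (auto simp: complex_eq_iff)

lemma ball_subset_slit_plane: "ball 0 1 \<subseteq> slit_plane"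
  by (auto simp: dist_norm)

lemma hyper_fps_nth:
  "fps_nth (hyper_fps A B C) k = pochhammer A k * pochhammer B k / (pochhammer C k * fact k)"
  by simp

text \<open>Only rearranges products of fractions and never cancels, so the equations it proves hold
  also under the convention \<open>x / 0 = 0\<close>.\<close>

lemmas frac_normalize =
  times_divide_times_eq divide_divide_eq_left times_divide_eq_left times_divide_eq_right mult_ac add_ac

lemma hyper_fps_nth_Suc:
  "fps_nth (hyper_fps A B C) (Suc k) =
     pochhammer A (Suc k) * pochhammer B (Suc k) / (pochhammer C (Suc k) * (fact k * (of_nat k + 1)))"
  by (simp add: algebra_simps)

lemma tendsto_shift_quotient:
  "(\<lambda>k. (x + of_nat k) / (y + of_nat k)) \<longlonglongrightarrow> 1" for x y :: complex
proof -
  have "filterlim (\<lambda>k. y + of_nat k) at_infinity sequentially"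
    by (intro tendsto_add_filterlim_at_infinity[OF tendsto_const] tendsto_of_nat)
  then have "(\<lambda>k. 1 + (x - y) / (y + of_nat k)) \<longlonglongrightarrow> 1 + 0"
    by (intro tendsto_add tendsto_divide_0[OF tendsto_const] tendsto_const)
  moreover have "eventually (\<lambda>k. y + of_nat k \<noteq> 0) sequentially"
    by (rule filterlim_at_infinity_imp_eventually_ne) fact
  then have "eventually (\<lambda>k. 1 + (x - y) / (y + of_nat k) = (x + of_nat k) / (y + of_nat k)) sequentially"
    by eventually_elim (simp add: field_simps)
  ultimately show ?thesis
    by (simp add: tendsto_cong)
qed

text \<open>Ratio test: the quotient of consecutive coefficients tends to 1. The quotient identity
  survives division by zero, which is why \<open>C\<close> is unrestricted.\<close>

lemma fps_conv_radius_hyper_fps: "fps_conv_radius (hyper_fps A B C) \<ge> 1"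
  unfolding fps_conv_radius_def
proof (rule conv_radius_geI_ex')
  fix r :: real
  assume r: "0 < r" "ereal r < 1"
  obtain s where s: "r < s" "s < 1"
    using r(2) dense[of r 1] by auto
  have "(\<lambda>k. norm ((A + of_nat k) / (C + of_nat k) * ((B + of_nat k) / (1 + of_nat k))) * r) \<longlonglongrightarrow> norm (1 * 1 :: complex) * r"
    by (intro tendsto_intros tendsto_shift_quotient)
  then have "eventually (\<lambda>k. norm ((A + of_nat k) / (C + of_nat k) * ((B + of_nat k) / (1 + of_nat k))) * r < s) sequentially"
    using s(1) by (intro order_tendstoD) auto
  then obtain N where N: "\<And>k. k \<ge> N \<Longrightarrow> norm ((A + of_nat k) / (C + of_nat k) * ((B + of_nat k) / (1 + of_nat k))) * r < s"
    unfolding eventually_sequentially by blast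
  show "summable (\<lambda>k. fps_nth (hyper_fps A B C) k * of_real r ^ k)"
  proof (rule summable_ratio_test[of s N])
    fix k assume k: "k \<ge> N"
    have "fps_nth (hyper_fps A B C) (Suc k) * of_real r ^ Suc k =
      ((A + of_nat k) / (C + of_nat k) * ((B + of_nat k) / (1 + of_nat k)) * of_real r)
        * (fps_nth (hyper_fps A B C) k * of_real r ^ k)"
      unfolding hyper_fps_nth_Suc unfolding hyper_fps_nth pochhammer_Suc power_Suc
      by (simp only: frac_normalize)
    then have "norm (fps_nth (hyper_fps A B C) (Suc k) * of_real r ^ Suc k) =
      (norm ((A + of_nat k) / (C + of_nat k) * ((B + of_nat k) / (1 + of_nat k))) * r)
        * norm (fps_nth (hyper_fps A B C) k * of_real r ^ k)"
      using r(1) by (simp only: norm_mult norm_of_real abs_of_pos)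
    also have "\<dots> \<le> s * norm (fps_nth (hyper_fps A B C) k * of_real r ^ k)"
      using N[OF k] by (intro mult_right_mono) auto
    finally show "norm (fps_nth (hyper_fps A B C) (Suc k) * of_real r ^ Suc k) \<le> s * norm (fps_nth (hyper_fps A B C) k * of_real r ^ k)" .
  qed (use s in auto)
qed

text \<open>Turns a power series identity at 0 into an identity at -1, where the series itself may
  diverge. All contiguity relations below pass through this lemma.\<close>

lemma eq_zero_on_slit_plane:
  assumes "f has_fps_expansion 0" "f holomorphic_on slit_plane" "z \<in> slit_plane"
  shows "f z = 0"
  by (rule has_fps_expansion_0_analytic_continuation[OF assms(1,2)])
     (use assms(3) open_slit_plane connected_slit_plane in \<open>auto simp: complex_eq_iff\<close>)

text \<open>Existence of the function that \<open>hyp2F1\<close> selects. Asking only for the germ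
  at 0 lets first-order operators be applied to witness and series in parallel.\<close>

definition hyper_continuable :: "complex \<Rightarrow> complex \<Rightarrow> complex \<Rightarrow> bool" where
  "hyper_continuable A B C \<longleftrightarrow>
     (\<exists>F. F holomorphic_on slit_plane \<and> F has_fps_expansion hyper_fps A B C)"

lemma add_of_nat_neq_0:
  fixes C :: complex
  assumes "C \<notin> \<int>\<^sub>\<le>\<^sub>0"
  shows "C + of_nat n \<noteq> 0"
  using assms by (metis eq_neg_iff_add_eq_0 minus_of_nat_in_nonpos_Ints)

lemma pochhammer_neq_0:
  fixes C :: complex
  assumes "C \<notin> \<int>\<^sub>\<le>\<^sub>0"
  shows "pochhammer C n \<noteq> 0"
  using assms by (auto simp: pochhammer_eq_0_iff)

lemma pochhammer_plus1:
  fixes C :: complex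
  assumes "C \<noteq> 0"
  shows "pochhammer (C + 1) n = pochhammer C n * (C + of_nat n) / C"
  using assms pochhammer_rec[of C n] pochhammer_Suc[of C n] by (simp add: field_simps)

text \<open>The operator \<open>(z d/dz + C) / C\<close> multiplies the coefficient of
  \<open>z^n\<close> by \<open>(C + n) / C\<close>, the quotient of
  \<open>pochhammer (C + 1) n\<close> by \<open>pochhammer C n\<close>.\<close>

lemma hyper_continuable_lower_C:
  assumes "hyper_continuable A B (C + 1)" "C \<notin> \<int>\<^sub>\<le>\<^sub>0"
  shows "hyper_continuable A B C"
proof -
  from assms(1) obtain F where F: "F holomorphic_on slit_plane" "F has_fps_expansion hyper_fps A B (C + 1)"
    unfolding hyper_continuable_def by blast
  have "fps_const (1 / C) * (fps_X * fps_deriv (hyper_fps A B (C + 1)) + fps_const C * hyper_fps A B (C + 1))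
      = hyper_fps A B C"
  proof (rule fps_ext)
    fix n
    have C: "C \<noteq> 0" using add_of_nat_neq_0[OF assms(2), of 0] by simp
    note C add_of_nat_neq_0[OF assms(2), of n] pochhammer_neq_0[OF assms(2), of n]
    then show "fps_nth (fps_const (1 / C) * (fps_X * fps_deriv (hyper_fps A B (C + 1)) + fps_const C * hyper_fps A B (C + 1))) n
      = fps_nth (hyper_fps A B C) n"
      unfolding fps_mult_fps_X_deriv_shift by (simp add: pochhammer_plus1[OF C] divide_simps) algebra
  qed
  moreover have "(\<lambda>z. 1 / C * (z * deriv F z + C * F z)) has_fps_expansion
      fps_const (1 / C) * (fps_X * fps_deriv (hyper_fps A B (C + 1)) + fps_const C * hyper_fps A B (C + 1))"
    by (intro fps_expansion_intros F)
  moreover have "(\<lambda>z. 1 / C * (z * deriv F z + C * F z)) holomorphic_on slit_plane"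
    by (intro holomorphic_intros F open_slit_plane)
  ultimately show ?thesis
    unfolding hyper_continuable_def by auto
qed

text \<open>\<open>z d/dz + B\<close> raises \<open>B\<close>; inverting it with the hypergeometric
  equation gives \<open>z (1 - z) d/dz + (C - B - 1 - A z)\<close>, which yields
  \<open>C - B - 1\<close> times the wanted series. Hence the condition that this number is
  nonzero.\<close>

lemma hyper_continuable_lower_B:
  assumes "hyper_continuable A (B + 1) C" "C \<notin> \<int>\<^sub>\<le>\<^sub>0" "C - B - 1 \<noteq> 0"
  shows "hyper_continuable A B C"
proof -
  from assms(1) obtain F where F: "F holomorphic_on slit_plane" "F has_fps_expansion hyper_fps A (B + 1) C"
    unfolding hyper_continuable_def by blast
  define c where "c = C - B - 1"
  have c: "c \<noteq> 0" using assms(3) by (simp add: c_def)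
  let ?H = "hyper_fps A (B + 1) C"
  let ?G = "fps_const (1 / c) * (fps_X * fps_deriv ?H - fps_X * (fps_X * fps_deriv ?H)
     + (fps_const c * ?H - fps_X * (fps_const A * ?H)))"
  have "?G = hyper_fps A B C"
  proof (rule fps_ext)
    fix n
    show "fps_nth ?G n = fps_nth (hyper_fps A B C) n"
    proof (cases n)
      case 0
      then show ?thesis using c by simp
    next
      case (Suc k)
      define x :: complex where "x = of_nat k"
      \<comment> \<open>\<open>W\<close> collects the factors shared by all coefficients that occur.
        Factoring it out leaves a polynomial identity in the parameters and \<open>x\<close>; the
        contiguity relations below use the same device.\<close>
      define W where "W = pochhammer A k * pochhammer (B + 1) k / (pochhammer C k * fact k * (C + x) * (x + 1))"
      have nz: "C + x \<noteq> 0" "pochhammer C k \<noteq> 0" "x + 1 \<noteq> 0"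
        using assms(2) of_nat_neq_0[of k, where ?'a = complex]
        by (auto simp: add_of_nat_neq_0 pochhammer_neq_0 x_def add.commute)
      have 1: "fps_nth ?H k = W * ((C + x) * (x + 1))"
        using nz by (simp add: W_def)
      have 2: "fps_nth ?H (Suc k) = W * ((A + x) * (B + 1 + x))"
        unfolding hyper_fps_nth_Suc pochhammer_Suc W_def x_def
        by (simp only: frac_normalize)
      have 3: "fps_nth (hyper_fps A B C) (Suc k) = W * ((A + x) * B)"
        unfolding hyper_fps_nth_Suc pochhammer_Suc[of A] pochhammer_Suc[of C] pochhammer_rec[of B] W_def x_def
        by (simp only: frac_normalize)
      have "fps_nth ?G (Suc k) = 1 / c * ((x + 1 + c) * fps_nth ?H (Suc k) - (x + A) * fps_nth ?H k)"
        unfolding fps_mult_fps_X_deriv_shift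
        by (simp add: x_def ring_distribs del: fps_hypergeo_nth)
      also have "\<dots> = 1 / c * W * ((x + 1 + c) * ((A + x) * (B + 1 + x)) - (x + A) * ((C + x) * (x + 1)))"
        unfolding 1 2 by (simp add: algebra_simps)
      also have "(x + 1 + c) * ((A + x) * (B + 1 + x)) - (x + A) * ((C + x) * (x + 1)) = c * ((A + x) * B)"
        unfolding c_def by algebra
      finally show ?thesis
        unfolding Suc 3 using c by simp
    qed
  qed
  moreover have "(\<lambda>z. 1 / c * (z * deriv F z - z * (z * deriv F z) + (c * F z - z * (A * F z)))) has_fps_expansion ?G"
    by (intro fps_expansion_intros F)
  moreover have "(\<lambda>z. 1 / c * (z * deriv F z - z * (z * deriv F z) + (c * F z - z * (A * F z)))) holomorphic_on slit_plane"
    by (intro holomorphic_intros F open_slit_plane)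
  ultimately show ?thesis
    unfolding hyper_continuable_def by auto
qed

section \<open>Euler's integral for large real parts\<close>

definition euler_weight :: "complex \<Rightarrow> complex \<Rightarrow> real \<Rightarrow> complex" where
  "euler_weight B D t = of_real t powr (B - 1) * of_real (1 - t) powr (D - 1)"

lemma continuous_on_of_real_powr:
  assumes "Re s > 0"
  shows "continuous_on {0..} (\<lambda>t::real. complex_of_real t powr s)"
  using assms by (intro continuous_on_powr_complex continuous_intros) auto

text \<open>\<open>D\<close> will be \<open>C - B\<close>. Real parts above 1, not merely positive,
  keep both powers continuous at the endpoints and avoid improper integrals.\<close>

lemma continuous_on_euler_weight:
  assumes "Re B > 1" "Re D > 1"
  shows "continuous_on {0..1} (euler_weight B D)"
proof -
  have "continuous_on {0..1} (\<lambda>t::real. complex_of_real t powr (B - 1))"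
    using assms by (intro continuous_on_subset[OF continuous_on_of_real_powr]) auto
  moreover have "continuous_on {0..1} (\<lambda>t::real. complex_of_real (1 - t) powr (D - 1))"
    using assms by (intro continuous_on_compose2[OF continuous_on_of_real_powr[of "D - 1"]] continuous_intros) auto
  ultimately show ?thesis
    unfolding euler_weight_def by (intro continuous_on_mult)
qed

definition euler_moment :: "complex \<Rightarrow> complex \<Rightarrow> nat \<Rightarrow> complex" where
  "euler_moment B D k = integral {0..1} (\<lambda>t. euler_weight B D t * of_real t ^ k)"

lemma has_integral_euler_moment:
  assumes "Re B > 1" "Re D > 1"
  shows "((\<lambda>t. euler_weight B D t * of_real t ^ k) has_integral euler_moment B D k) {0..1}"
  unfolding euler_moment_def
  by (intro integrable_integral integrable_continuous_interval continuous_intros continuous_on_euler_weight assms)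

text \<open>Integrates the derivative of \<open>t^(B+k) (1-t)^D\<close>, whose boundary values are
  both 0.\<close>

lemma euler_moment_Suc:
  assumes B: "Re B > 1" and D: "Re D > 1"
  shows "(B + D + of_nat k) * euler_moment B D (Suc k) = (B + of_nat k) * euler_moment B D k"
proof -
  define F where "F = (\<lambda>t. complex_of_real t powr (B + of_nat k) * complex_of_real (1 - t) powr D)"
  define F' where "F' = (\<lambda>t. (B + of_nat k) * (euler_weight B D t * of_real t ^ k - euler_weight B D t * of_real t ^ Suc k)
      - D * (euler_weight B D t * of_real t ^ Suc k))"
  have "(F' has_integral (F 1 - F 0)) {0..1}"
  proof (rule fundamental_theorem_of_calculus_interior)
    have "continuous_on {0..1} (\<lambda>t::real. complex_of_real t powr (B + of_nat k))"
      using B by (intro continuous_on_subset[OF continuous_on_of_real_powr]) auto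
    moreover have "continuous_on {0..1} (\<lambda>t::real. complex_of_real (1 - t) powr D)"
      using D by (intro continuous_on_compose2[OF continuous_on_of_real_powr[of D]] continuous_intros) auto
    ultimately show "continuous_on {0..1} F"
      unfolding F_def by (intro continuous_on_mult)
  next
    fix t :: real assume t: "t \<in> {0<..<1}"
    define T where "T = complex_of_real t"
    have T: "T \<notin> \<real>\<^sub>\<le>\<^sub>0" "1 - T \<notin> \<real>\<^sub>\<le>\<^sub>0" "T \<noteq> 0" "1 - T \<noteq> 0"
      using t by (auto simp: T_def complex_nonpos_Reals_iff complex_eq_iff)
    have der: "((\<lambda>z. z powr (B + of_nat k) * (1 - z) powr D) has_field_derivative
       ((B + of_nat k) * T powr (B + of_nat k - 1) * (1 - T) powr D - D * (1 - T) powr (D - 1) * T powr (B + of_nat k))) (at T)"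
      using T by (auto intro!: derivative_eq_intros)
    have pw: "T powr (B + of_nat k) = T powr (B - 1) * T ^ Suc k" "T powr (B + of_nat k - 1) = T powr (B - 1) * T ^ k"
      "(1 - T) powr D = (1 - T) powr (D - 1) * (1 - T)"
    proof -
      have "T powr (B - 1) * T ^ j = T powr (B - 1 + of_nat j)" for j
        using T by (simp add: powr_add)
      from this[of "Suc k"] this[of k] show "T powr (B + of_nat k) = T powr (B - 1) * T ^ Suc k" "T powr (B + of_nat k - 1) = T powr (B - 1) * T ^ k"
        by (simp_all add: algebra_simps)
      show "(1 - T) powr D = (1 - T) powr (D - 1) * (1 - T)"
        using T by (simp add: powr_diff)
    qed
    have rew: "of_real t = T" "complex_of_real (1 - t) = 1 - T" by (simp_all add: T_def)
    have "(B + of_nat k) * T powr (B + of_nat k - 1) * (1 - T) powr D - D * (1 - T) powr (D - 1) * T powr (B + of_nat k) = F' t"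
      unfolding F'_def euler_weight_def rew pw power_Suc by (simp add: algebra_simps)
    from der[unfolded this]
    have "((\<lambda>z. z powr (B + of_nat k) * (1 - z) powr D) has_field_derivative F' t) (at (of_real t))"
      by (simp only: T_def)
    then show "(F has_vector_derivative F' t) (at t)"
      unfolding F_def of_real_diff of_real_1
      by (rule has_vector_derivative_real_field)
  qed auto
  moreover have "F 1 = 0" "F 0 = 0"
    using B D by (auto simp: F_def)
  ultimately have "(F' has_integral 0) {0..1}" by simp
  moreover have "(F' has_integral ((B + of_nat k) * (euler_moment B D k - euler_moment B D (Suc k)) - D * euler_moment B D (Suc k))) {0..1}"
    unfolding F'_def
    by (intro has_integral_diff has_integral_mult_right has_integral_euler_moment B D)
  ultimately have "(B + of_nat k) * (euler_moment B D k - euler_moment B D (Suc k)) - D * euler_moment B D (Suc k) = 0"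
    using has_integral_unique by blast
  then show ?thesis by (simp add: algebra_simps)
qed

lemma euler_moment_eq:
  assumes B: "Re B > 1" and D: "Re D > 1"
  shows "euler_moment B D k = pochhammer B k / pochhammer (B + D) k * euler_moment B D 0"
proof (induction k)
  case (Suc k)
  have "B + D + of_nat k \<noteq> 0"
  proof
    assume "B + D + of_nat k = 0"
    then have "Re (B + D + of_nat k) = 0" by (metis zero_complex.sel(1))
    then show False using B D by simp
  qed
  then have "euler_moment B D (Suc k) = (B + of_nat k) / (B + D + of_nat k) * euler_moment B D k"
    using euler_moment_Suc[OF B D, of k] by (simp add: nonzero_eq_divide_eq mult.commute)
  then show ?case unfolding Suc by (simp add: pochhammer_Suc mult_ac)
qed simp

text \<open>For every polynomial \<open>g\<close> the integral of \<open>f^2\<close> equals that of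
  \<open>f (f - g)\<close>; approximating \<open>f\<close> uniformly by \<open>g\<close> within
  \<open>e / M\<close> makes the latter at most \<open>e\<close>.\<close>

lemma continuous_moments_zero:
  fixes f :: "real \<Rightarrow> real"
  assumes cont: "continuous_on {0..1} f" and mom: "\<And>k. ((\<lambda>t. f t * t ^ k) has_integral 0) {0..1}"
    and x: "x \<in> {0..1}"
  shows "f x = 0"
proof -
  have poly0: "((\<lambda>t. f t * g t) has_integral 0) {0..1}" if g: "real_polynomial_function g" for g
  proof -
    obtain a n where g: "g = (\<lambda>x. \<Sum>i\<le>n. a i * x ^ i)"
      using g by (auto simp: real_polynomial_function_iff_sum)
    have "((\<lambda>t. \<Sum>i\<le>n. a i * (f t * t ^ i)) has_integral (\<Sum>i\<le>n. a i * 0)) {0..1}"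
      by (intro has_integral_sum has_integral_mult_right mom) auto
    moreover have "(\<Sum>i\<le>n. a i * (f t * t ^ i)) = f t * g t" for t
      by (simp add: g sum_distrib_left mult_ac)
    ultimately show ?thesis by simp
  qed
  have int: "(\<lambda>t. f t * f t) integrable_on {0..1}"
    by (intro integrable_continuous_interval continuous_intros cont)
  obtain M where M: "\<And>t. t \<in> {0..1} \<Longrightarrow> \<bar>f t\<bar> \<le> M" "M > 0"
  proof -
    have "bounded (f ` {0..1})"
      by (intro compact_imp_bounded compact_continuous_image cont) auto
    then obtain b where "b > 0" "\<forall>x\<in>{0..1}. \<bar>f x\<bar> \<le> b"
      by (auto simp: bounded_pos)
    then show ?thesis by (intro that[of b]) auto
  qed
  have "integral {0..1} (\<lambda>t. f t * f t) \<le> e" if "e > 0" for e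
  proof -
    have "e / M > 0" using that M(2) by simp
    then obtain g where g: "real_polynomial_function g" "\<And>t. t \<in> {0..1} \<Longrightarrow> \<bar>f t - g t\<bar> < e / M"
      using Stone_Weierstrass_real_polynomial_function[OF compact_Icc cont] by metis
    have "((\<lambda>t. f t * f t - f t * g t) has_integral (integral {0..1} (\<lambda>t. f t * f t) - 0)) {0..1}"
      by (intro has_integral_diff integrable_integral int poly0 g)
    moreover have "f t * f t - f t * g t \<le> e" if t: "t \<in> {0..1}" for t
    proof -
      have "f t * f t - f t * g t \<le> \<bar>f t\<bar> * \<bar>f t - g t\<bar>"
        by (simp add: abs_mult[symmetric] right_diff_distrib)
      also have "\<dots> \<le> M * (e / M)"
        using M(1)[OF t] g(2)[OF t] by (intro mult_mono) auto
      finally show ?thesis using M(2) by simp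
    qed
    ultimately have "integral {0..1} (\<lambda>t. f t * f t) - 0 \<le> e * (1 - 0)"
      using has_integral_le[OF _ has_integral_const_real[of e 0 1]] by (auto simp: mult.commute)
    then show ?thesis by simp
  qed
  then have "integral {0..1} (\<lambda>t. f t * f t) \<le> 0"
    by (rule field_le_epsilon) auto
  moreover have "integral {0..1} (\<lambda>t. f t * f t) \<ge> 0"
    by (intro integral_nonneg int) auto
  ultimately have "((\<lambda>t. f t * f t) has_integral 0) {0..1}"
    using int by (metis antisym integrable_integral)
  then have "f x * f x = 0"
    using x by (intro has_integral_0_cbox_imp_0[of 0 1 "\<lambda>t. f t * f t" x]) (auto intro!: continuous_intros cont)
  then show ?thesis by simp
qed

text \<open>
  If the total mass vanished, all moments would vanish by their recurrence, and the weight would be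
  zero by the Weierstrass approximation theorem.
\<close>

lemma euler_moment_nonzero:
  assumes B: "Re B > 1" and D: "Re D > 1"
  shows "euler_moment B D 0 \<noteq> 0"
proof
  assume "euler_moment B D 0 = 0"
  then have mom: "((\<lambda>t. euler_weight B D t * of_real t ^ k) has_integral 0) {0..1}" for k
    using has_integral_euler_moment[OF B D, of k] euler_moment_eq[OF B D, of k] by simp
  have Re_mom: "((\<lambda>t. Re (euler_weight B D t) * t ^ k) has_integral 0) {0..1}" for k
    using has_integral_linear[OF mom[of k] bounded_linear_Re] by (simp add: o_def flip: of_real_power)
  have Im_mom: "((\<lambda>t. Im (euler_weight B D t) * t ^ k) has_integral 0) {0..1}" for k
    using has_integral_linear[OF mom[of k] bounded_linear_Im] by (simp add: o_def flip: of_real_power)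
  have "Re (euler_weight B D (1/2)) = 0" "Im (euler_weight B D (1/2)) = 0"
    by (rule continuous_moments_zero[OF _ Re_mom] continuous_moments_zero[OF _ Im_mom];
        auto intro!: continuous_intros continuous_on_euler_weight B D)+
  then have "euler_weight B D (1/2) = 0" by (simp add: complex_eq_iff)
  then show False by (simp add: euler_weight_def)
qed


text \<open>Keeps the base of Euler's integrand off the cut of the principal power:
  \<open>1 - z t = r\<close> with \<open>r \<le> 0\<close> would give
  \<open>z = (1 - r) / t\<close>, a real number at least 1.\<close>

lemma slit_plane_segment:
  assumes "z \<in> slit_plane" "t \<in> {0..1}"
  shows "1 - z * of_real t \<notin> \<real>\<^sub>\<le>\<^sub>0"
proof
  assume "1 - z * of_real t \<in> \<real>\<^sub>\<le>\<^sub>0"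
  then obtain r where r: "1 - z * of_real t = of_real r" "r \<le> 0"
    by (auto elim: nonpos_Reals_cases)
  then have zt: "z * of_real t = of_real (1 - r)" by (simp add: algebra_simps)
  with r(2) have t: "t > 0" using assms(2) by (cases "t = 0") auto
  have "z = of_real ((1 - r) / t)"
    using zt t by (simp add: field_simps)
  moreover have "(1 - r) / t \<ge> 1"
    using t assms(2) r(2) by (simp add: field_simps)
  ultimately have "z \<in> complex_of_real ` {1..}" by blast
  then show False using assms(1) by blast
qed

lemma continuous_on_powr_slit:
  fixes f :: "'a::topological_space \<Rightarrow> complex"
  assumes "continuous_on S f" "\<And>x. x \<in> S \<Longrightarrow> f x \<notin> \<real>\<^sub>\<le>\<^sub>0"
  shows "continuous_on S (\<lambda>x. f x powr s)"
  unfolding continuous_on_def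
proof
  fix x assume "x \<in> S"
  then show "((\<lambda>x. f x powr s) \<longlongrightarrow> f x powr s) (at x within S)"
    using assms by (intro tendsto_powr_complex tendsto_const) (auto simp: continuous_on_def)
qed

lemma euler_integral_holomorphic:
  assumes B: "Re B > 1" and D: "Re D > 1"
  shows "(\<lambda>z. integral {0..1} (\<lambda>t. euler_weight B D t * (1 - z * of_real t) powr (-A))) holomorphic_on slit_plane"
  unfolding holomorphic_on_def
proof
  fix z0 assume z0: "z0 \<in> slit_plane"
  then obtain r where r: "r > 0" "ball z0 r \<subseteq> slit_plane"
    using open_slit_plane open_contains_ball by blast
  define f' where "f' = (\<lambda>z t. euler_weight B D t * (A * of_real t * (1 - z * of_real t) powr (-A - 1)))"
  have "(\<lambda>z. integral (cbox 0 1) (\<lambda>t. euler_weight B D t * (1 - z * of_real t) powr (-A))) field_differentiable at z0 within ball z0 r"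
  proof (rule leibniz_rule_field_differentiable[where fx = f'])
    fix z t assume "z \<in> ball z0 r" "t \<in> cbox 0 (1::real)"
    then have nz: "1 - z * of_real t \<notin> \<real>\<^sub>\<le>\<^sub>0"
      using r(2) by (intro slit_plane_segment) auto
    show "((\<lambda>z. euler_weight B D t * (1 - z * of_real t) powr (-A)) has_field_derivative f' z t) (at z within ball z0 r)"
      unfolding f'_def using nz by (auto intro!: derivative_eq_intros)
  next
    fix z assume z: "z \<in> ball z0 r"
    have "continuous_on {0..1} (\<lambda>t. euler_weight B D t * (1 - z * of_real t) powr (-A))"
      using r(2) z by (intro continuous_on_mult continuous_on_euler_weight continuous_on_powr_slit slit_plane_segment
          continuous_intros B D) auto
    then show "(\<lambda>t. euler_weight B D t * (1 - z * of_real t) powr (-A)) integrable_on cbox 0 1"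
      by (intro integrable_continuous) simp
  next
    have w: "continuous_on (ball z0 r \<times> {0..1}) (\<lambda>x. euler_weight B D (snd x))"
      by (intro continuous_on_compose2[OF continuous_on_euler_weight[OF B D]] continuous_intros) auto
    have "continuous_on (ball z0 r \<times> {0..1}) (\<lambda>x. euler_weight B D (snd x) * (A * of_real (snd x) * (1 - fst x * of_real (snd x)) powr (-A - 1)))"
      using r(2) by (intro continuous_on_mult w continuous_on_powr_slit slit_plane_segment continuous_intros) auto
    then show "continuous_on (ball z0 r \<times> cbox 0 1) (\<lambda>(z, t). f' z t)"
      by (simp add: f'_def case_prod_unfold)
  qed (use r in auto)
  then have "(\<lambda>z. integral {0..1} (\<lambda>t. euler_weight B D t * (1 - z * of_real t) powr (-A))) field_differentiable at z0"
    using r(1) by (simp add: at_within_open[of z0 "ball z0 r"])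
  then show "(\<lambda>z. integral {0..1} (\<lambda>t. euler_weight B D t * (1 - z * of_real t) powr (-A))) field_differentiable at z0 within slit_plane"
    by (rule field_differentiable_at_within)
qed

text \<open>Termwise integration of the binomial series of \<open>(1 - z t)^(-A)\<close>, which
  converges uniformly for \<open>t\<close> in the unit interval.\<close>

lemma euler_integral_sums:
  assumes B: "Re B > 1" and D: "Re D > 1" and z: "norm z < 1"
  shows "(\<lambda>k. pochhammer A k / fact k * euler_moment B D k * z ^ k) sums
    integral {0..1} (\<lambda>t. euler_weight B D t * (1 - z * of_real t) powr (-A))"
proof -
  define c where "c = (\<lambda>k. pochhammer A k / fact k * z ^ k)"
  define g where "g = (\<lambda>t. euler_weight B D t * (1 - z * of_real t) powr (-A))"
  obtain M where M: "\<And>t. t \<in> {0..1} \<Longrightarrow> norm (euler_weight B D t) \<le> M" "M > 0"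
  proof -
    have "bounded (euler_weight B D ` {0..1})"
      by (intro compact_imp_bounded compact_continuous_image continuous_on_euler_weight B D) auto
    then obtain b where "b > 0" "\<forall>x\<in>{0..1}. norm (euler_weight B D x) \<le> b"
      by (auto simp: bounded_pos)
    then show ?thesis by (intro that[of b]) auto
  qed
  \<comment> \<open>With both other parameters equal to 1 the hypergeometric coefficients are
    \<open>pochhammer A k / fact k\<close>, so the radius bound gives absolute convergence of the
    binomial series.\<close>
  have "ereal (norm z) < fps_conv_radius (hyper_fps A 1 1)"
    by (rule less_le_trans[OF _ fps_conv_radius_hyper_fps]) (simp add: z)
  from norm_summable_fps[OF this] have "summable (\<lambda>k. norm (c k))"
    by (simp add: c_def flip: pochhammer_fact)
  then have sM: "summable (\<lambda>k. M * norm (c k))" by (rule summable_mult)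
  have series: "(\<Sum>k. euler_weight B D t * (c k * of_real t ^ k)) = g t" if t: "t \<in> {0..1}" for t
  proof -
    have "norm (z * of_real t) < 1"
      using z t by (simp add: norm_mult) (metis abs_of_nonneg le_less_trans mult_left_le norm_ge_zero)
    then have "(\<lambda>n. (-A gchoose n) * (- (z * of_real t)) ^ n) sums (1 + (- (z * of_real t))) powr (-A)"
      by (intro gen_binomial_complex) simp
    moreover have "(-A gchoose n) * (- (z * of_real t)) ^ n = c n * of_real t ^ n" for n
      by (simp add: gbinomial_pochhammer c_def power_minus[of "z * of_real t"] power_mult_distrib)
    ultimately have "(\<lambda>n. c n * of_real t ^ n) sums (1 - z * of_real t) powr (-A)" by simp
    then have "(\<lambda>n. euler_weight B D t * (c n * of_real t ^ n)) sums g t"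
      unfolding g_def by (rule sums_mult)
    then show ?thesis by (rule sums_unique[symmetric])
  qed
  have "uniform_limit {0..1} (\<lambda>n t. \<Sum>k<n. euler_weight B D t * (c k * of_real t ^ k)) (\<lambda>t. \<Sum>k. euler_weight B D t * (c k * of_real t ^ k)) sequentially"
  proof (rule Weierstrass_m_test[OF _ sM])
    fix n and t :: real assume t: "t \<in> {0..1}"
    have "norm (euler_weight B D t * (c n * of_real t ^ n)) = norm (euler_weight B D t) * norm (c n) * \<bar>t\<bar> ^ n"
      by (simp add: norm_mult norm_power)
    also have "\<dots> \<le> M * norm (c n) * 1"
      using M(1)[OF t] M(2) t by (intro mult_mono power_le_one) auto
    finally show "norm (euler_weight B D t * (c n * of_real t ^ n)) \<le> M * norm (c n)" by simp
  qed
  moreover have "uniform_limit {0..1} (\<lambda>n t. \<Sum>k<n. euler_weight B D t * (c k * of_real t ^ k)) (\<lambda>t. \<Sum>k. euler_weight B D t * (c k * of_real t ^ k)) sequentially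
      \<longleftrightarrow> uniform_limit {0..1} (\<lambda>n t. \<Sum>k<n. euler_weight B D t * (c k * of_real t ^ k)) g sequentially"
    by (rule uniform_limit_cong'[OF refl series])
  ultimately have ul: "uniform_limit (cbox 0 1) (\<lambda>n t. \<Sum>k<n. euler_weight B D t * (c k * of_real t ^ k)) g sequentially"
    unfolding cbox_interval by blast
  obtain I J where IJ: "\<And>n. ((\<lambda>t. \<Sum>k<n. euler_weight B D t * (c k * of_real t ^ k)) has_integral I n) (cbox 0 1)"
    "(g has_integral J) (cbox 0 1)" "I \<longlonglongrightarrow> J"
  proof (rule uniform_limit_integral_cbox[OF ul])
    show "continuous_on (cbox 0 1) (\<lambda>t. \<Sum>k<n. euler_weight B D t * (c k * of_real t ^ k))" for n
      unfolding cbox_interval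
      by (intro continuous_on_sum continuous_on_mult continuous_on_euler_weight continuous_on_const
          continuous_on_power continuous_on_of_real continuous_on_id B D)
  qed auto
  have "I n = (\<Sum>k<n. c k * euler_moment B D k)" for n
  proof -
    have "((\<lambda>t. \<Sum>k<n. c k * (euler_weight B D t * of_real t ^ k)) has_integral (\<Sum>k<n. c k * euler_moment B D k)) {0..1}"
      by (intro has_integral_sum has_integral_mult_right has_integral_euler_moment B D) auto
    then have "((\<lambda>t. \<Sum>k<n. euler_weight B D t * (c k * of_real t ^ k)) has_integral (\<Sum>k<n. c k * euler_moment B D k)) (cbox 0 1)"
      unfolding cbox_interval by (simp only: mult.left_commute)
    with IJ(1)[of n] show ?thesis by (rule has_integral_unique)
  qed
  then have "(\<lambda>k. c k * euler_moment B D k) sums J"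
    using IJ(3) unfolding sums_def by presburger
  moreover have "J = integral {0..1} g"
    using IJ(2) by (simp add: integral_unique)
  moreover have "c k * euler_moment B D k = pochhammer A k / fact k * euler_moment B D k * z ^ k" for k
    by (simp add: c_def)
  ultimately show ?thesis by (simp add: g_def)
qed

section \<open>Continuation for all admissible parameters\<close>

lemma hyper_continuable_Euler:
  assumes B: "Re B > 1" and D: "Re (C - B) > 1"
  shows "hyper_continuable A B C"
proof -
  define J where "J = euler_moment B (C - B) 0"
  have J: "J \<noteq> 0" unfolding J_def by (rule euler_moment_nonzero[OF B D])
  define F where "F = (\<lambda>z. 1 / J * integral {0..1} (\<lambda>t. euler_weight B (C - B) t * (1 - z * of_real t) powr (-A)))"
  have "F holomorphic_on slit_plane"
    unfolding F_def by (intro holomorphic_on_mult holomorphic_on_const euler_integral_holomorphic B D)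
  moreover have "F has_fps_expansion hyper_fps A B C"
  proof (rule has_fps_expansionI)
    have sums: "(\<lambda>n. fps_nth (hyper_fps A B C) n * u ^ n) sums F u" if "u \<in> ball 0 1" for u
    proof -
      have "norm u < 1" using that by simp
      note sums_mult[OF euler_integral_sums[OF B D this, of A], of "1 / J"]
      moreover have "1 / J * (pochhammer A n / fact n * euler_moment B (C - B) n * u ^ n) = fps_nth (hyper_fps A B C) n * u ^ n" for n
        using euler_moment_eq[OF B D, of n] J by (simp add: J_def mult_ac)
      ultimately show ?thesis by (simp add: F_def)
    qed
    have "eventually (\<lambda>u. u \<in> ball 0 1) (nhds (0::complex))"
      by (intro eventually_nhds_in_open) auto
    then show "eventually (\<lambda>u. (\<lambda>n. fps_nth (hyper_fps A B C) n * u ^ n) sums F u) (nhds 0)"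
      by eventually_elim (rule sums)
  qed
  ultimately show ?thesis
    unfolding hyper_continuable_def by blast
qed

lemma not_nonpos_Ints_plus_of_nat:
  fixes C :: complex
  assumes "C \<notin> \<int>\<^sub>\<le>\<^sub>0"
  shows "C + of_nat n \<notin> \<int>\<^sub>\<le>\<^sub>0"
proof (induction n)
  case (Suc n)
  then show ?case
    using plus_one_in_nonpos_Ints_imp[of "C + of_nat n"] by (auto simp: add_ac)
qed (use assms in auto)

lemma hyper_continuable:
  assumes "C \<notin> \<int>\<^sub>\<le>\<^sub>0"
  shows "hyper_continuable A B C"
proof -
  \<comment> \<open>\<open>N\<close> brings the real part of \<open>B + N\<close> above 1, and
    \<open>M\<close> that of \<open>C + M - (B + N)\<close>. Lowering \<open>B\<close> first, while
    \<open>C + M\<close> is still large, keeps \<open>C + M - B' - 1\<close> nonzero for every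
    intermediate \<open>B'\<close>.\<close>
  obtain N :: nat where N: "1 - Re B < N"
    using reals_Archimedean2 by blast
  obtain M :: nat where M: "Re B + N + 1 - Re C < M"
    using reals_Archimedean2 by blast
  note CM = not_nonpos_Ints_plus_of_nat[OF assms]
  have "hyper_continuable A (B + of_nat (N - k)) (C + of_nat M)" if "k \<le> N" for k
    using that
  proof (induction k)
    case 0
    have "Re (B + of_nat N) > 1" "Re (C + of_nat M - (B + of_nat N)) > 1"
      using N M by auto
    then show ?case
      by (simp add: hyper_continuable_Euler)
  next
    case (Suc k)
    then have e: "N - k = Suc (N - Suc k)" by simp
    have "real (N - Suc k) + 1 \<le> N" using Suc.prems by linarith
    then have "Re (C + of_nat M - (B + of_nat (N - Suc k)) - 1) > 0"
      using M by simp
    then have "C + of_nat M - (B + of_nat (N - Suc k)) - 1 \<noteq> 0"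
      by (metis zero_complex.sel(1) less_irrefl)
    moreover have "hyper_continuable A (B + of_nat (N - Suc k) + 1) (C + of_nat M)"
      using Suc unfolding e by (simp add: add_ac)
    ultimately show ?case
      by (rule hyper_continuable_lower_B[OF _ CM, rotated])
  qed
  from this[of N] have B: "hyper_continuable A B (C + of_nat M)" by simp
  have "hyper_continuable A B (C + of_nat (M - k))" if "k \<le> M" for k
    using that
  proof (induction k)
    case (Suc k)
    then have e: "M - k = Suc (M - Suc k)" by simp
    have "hyper_continuable A B (C + of_nat (M - Suc k) + 1)"
      using Suc unfolding e by (simp add: add_ac)
    then show ?case
      by (rule hyper_continuable_lower_C[OF _ CM])
  qed (use B in auto)
  from this[of M] show ?thesis by simp
qed

text \<open>Turns the choice operator into usable facts: by the identity theorem the germ found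
  above agrees with the series on the whole unit disc, so a function as required in
  \<open>hyp2F1\<close> exists.\<close>

lemma hyp2F1_continuation:
  assumes C: "C \<notin> \<int>\<^sub>\<le>\<^sub>0"
  shows "hyp2F1 A B C holomorphic_on slit_plane \<and>
    (\<forall>z\<in>ball 0 1. hyp2F1 A B C z = eval_fps (hyper_fps A B C) z)"
proof -
  obtain F where F: "F holomorphic_on slit_plane" "F has_fps_expansion hyper_fps A B C"
    using hyper_continuable[OF C] unfolding hyper_continuable_def by blast
  have ball: "ball 0 1 \<subseteq> eball 0 (fps_conv_radius (hyper_fps A B C))"
    by (intro ball_eball_mono) (simp add: fps_conv_radius_hyper_fps flip: one_ereal_def)
  have "F z = eval_fps (hyper_fps A B C) z" if "z \<in> ball 0 1" for z
  proof -
    have "F z - eval_fps (hyper_fps A B C) z = 0"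
    proof (rule has_fps_expansion_0_analytic_continuation[where A = "ball 0 1"
          and f = "\<lambda>z. F z - eval_fps (hyper_fps A B C) z"])
      show "(\<lambda>z. F z - eval_fps (hyper_fps A B C) z) has_fps_expansion 0"
        using has_fps_expansion_diff[OF F(2) eval_fps_has_fps_expansion[of "hyper_fps A B C"]]
          fps_conv_radius_hyper_fps[of A B C] less_le_trans[of 0 "1::ereal"] by simp
      show "(\<lambda>z. F z - eval_fps (hyper_fps A B C) z) holomorphic_on ball 0 1"
        by (intro holomorphic_intros holomorphic_on_subset[OF F(1) ball_subset_slit_plane] ball)
    qed (use that in auto)
    then show ?thesis by simp
  qed
  then have "\<exists>F. F holomorphic_on slit_plane \<and> (\<forall>z\<in>ball 0 1. F z = eval_fps (hyper_fps A B C) z)"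
    using F(1) by blast
  then show ?thesis
    unfolding hyp2F1_def by (rule someI_ex)
qed

lemmas hyp2F1_holomorphic = hyp2F1_continuation[THEN conjunct1]

lemmas hyp2F1_eval_fps = hyp2F1_continuation[THEN conjunct2, rule_format]

lemma hyp2F1_has_fps_expansion:
  assumes "C \<notin> \<int>\<^sub>\<le>\<^sub>0"
  shows "hyp2F1 A B C has_fps_expansion hyper_fps A B C"
  unfolding has_fps_expansion_def
proof
  show "fps_conv_radius (hyper_fps A B C) > 0"
    using fps_conv_radius_hyper_fps[of A B C] less_le_trans[of 0 "1::ereal"] by simp
  have "eventually (\<lambda>z. z \<in> ball 0 1) (nhds (0::complex))"
    by (intro eventually_nhds_in_open) auto
  then show "eventually (\<lambda>z. eval_fps (hyper_fps A B C) z = hyp2F1 A B C z) (nhds 0)"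
    by eventually_elim (simp add: hyp2F1_eval_fps[OF assms])
qed

lemma not_nonpos_Ints_plus1:
  fixes C :: complex
  assumes "C \<notin> \<int>\<^sub>\<le>\<^sub>0"
  shows "C + 1 \<notin> \<int>\<^sub>\<le>\<^sub>0"
  using assms plus_one_in_nonpos_Ints_imp by blast

lemma not_nonpos_Ints_plus2:
  fixes C :: complex
  assumes "C \<notin> \<int>\<^sub>\<le>\<^sub>0"
  shows "C + 2 \<notin> \<int>\<^sub>\<le>\<^sub>0"
  using not_nonpos_Ints_plus1[OF not_nonpos_Ints_plus1[OF assms]] by (simp add: add.assoc)

lemma pochhammer_plus2:
  "pochhammer (C + 1) (Suc k) = (C + 1) * pochhammer (C + 2) k" for C :: complex
  using pochhammer_rec[of "C + 1" k] by (simp add: add_ac)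

lemma hyper_fps_nth_Suc_Suc:
  "fps_nth (hyper_fps A B C) (Suc (Suc k)) =
     pochhammer A (Suc (Suc k)) * pochhammer B (Suc (Suc k)) /
     (pochhammer C (Suc (Suc k)) * (fact k * (of_nat k + 1) * (of_nat k + 2)))"
  unfolding hyper_fps_nth_Suc by (simp add: algebra_simps)

section \<open>Contiguity relations at minus one\<close>

text \<open>Gauss' relation for general \<open>z\<close> is the one in \<open>?f\<close>, with
  coefficients \<open>C - A - 1\<close>, \<open>2 A + 2 - C + (B - A - 1) z\<close> and
  \<open>(A + 1) (z - 1)\<close>. The factor 2 on the right is \<open>1 - z\<close> at -1.\<close>

lemma hyp2F1_contiguous_A:
  assumes C: "C \<notin> \<int>\<^sub>\<le>\<^sub>0"
  shows "(C - A - 1) * hyp2F1 A B C (-1) + (2 * A + 2 - C - (B - A - 1)) * hyp2F1 (A + 1) B C (-1)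
    = 2 * (A + 1) * hyp2F1 (A + 2) B C (-1)"
proof -
  note E = hyp2F1_has_fps_expansion[OF C] hyp2F1_holomorphic[OF C]
  let ?f = "\<lambda>z. (C - A - 1) * hyp2F1 A B C z + ((2 * A + 2 - C) * hyp2F1 (A + 1) B C z + z * ((B - A - 1) * hyp2F1 (A + 1) B C z))
    + (z * ((A + 1) * hyp2F1 (A + 2) B C z) - (A + 1) * hyp2F1 (A + 2) B C z)"
  let ?F = "fps_const (C - A - 1) * hyper_fps A B C + (fps_const (2 * A + 2 - C) * hyper_fps (A + 1) B C
      + fps_X * (fps_const (B - A - 1) * hyper_fps (A + 1) B C))
    + (fps_X * (fps_const (A + 1) * hyper_fps (A + 2) B C) - fps_const (A + 1) * hyper_fps (A + 2) B C)"
  have "?F = 0"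
  proof (rule fps_ext)
    fix n
    \<comment> \<open>The first parameter varies by two, and \<open>W\<close> absorbs
      \<open>pochhammer (A + 2) k\<close>; the coefficients of index 0 and 1 lie outside this
      uniform computation.\<close>
    consider "n = 0" | "n = 1" | k where "n = Suc (Suc k)"
      by (metis One_nat_def not0_implies_Suc)
    then show "fps_nth ?F n = fps_nth 0 n"
    proof cases
      case 1
      then show ?thesis by (simp add: algebra_simps)
    next
      case 2
      have "C \<noteq> 0" using C by auto
      then have "fps_nth ?F 1 = B / C * ((C - A - 1) * A + (2 * A + 2 - C) * (A + 1) + C - (A + 1) * (A + 2))"
        by (simp add: field_simps)
      also have "(C - A - 1) * A + (2 * A + 2 - C) * (A + 1) + C - (A + 1) * (A + 2) = 0"
        by algebra
      finally show ?thesis using 2 by simp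
    next
      case 3
      define x :: complex where "x = of_nat k"
      define W where "W = (A + 1) * pochhammer (A + 2) k * (B + x) * pochhammer B k
        / (pochhammer C k * fact k * (C + x) * (C + x + 1) * (x + 1) * (x + 2))"
      have nz: "C + x \<noteq> 0" "C + x + 1 \<noteq> 0" "pochhammer C k \<noteq> 0" "x + 1 \<noteq> 0" "x + 2 \<noteq> 0"
        using C of_nat_neq_0[of k, where ?'a = complex] of_nat_neq_0[of "Suc k", where ?'a = complex]
          add_of_nat_neq_0[OF C, of "Suc k"]
        by (auto simp: add_of_nat_neq_0 pochhammer_neq_0 x_def add_ac)
      have Suc_x: "of_nat (Suc k) = x + 1" by (simp add: x_def)
      have 1: "fps_nth (hyper_fps A B C) (Suc (Suc k)) = W * (A * (B + x + 1))"
        unfolding hyper_fps_nth_Suc_Suc pochhammer_rec[of A] pochhammer_plus2 pochhammer_Suc[of B] pochhammer_Suc[of C]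
          W_def Suc_x x_def[symmetric]
        by (simp only: frac_normalize)
      have 2: "fps_nth (hyper_fps (A + 1) B C) (Suc (Suc k)) = W * ((A + 2 + x) * (B + x + 1))"
        unfolding hyper_fps_nth_Suc_Suc pochhammer_plus2 pochhammer_Suc[of "A + 2"] pochhammer_Suc[of B] pochhammer_Suc[of C]
          W_def Suc_x x_def[symmetric]
        by (simp only: frac_normalize)
      have 3: "(A + 1) * fps_nth (hyper_fps (A + 2) B C) (Suc (Suc k)) = W * ((A + 2 + x) * (A + 3 + x) * (B + x + 1))"
        unfolding hyper_fps_nth_Suc_Suc pochhammer_Suc[of "A + 2"] pochhammer_Suc[of B] pochhammer_Suc[of C]
          W_def Suc_x x_def[symmetric]
        by (simp only: frac_normalize) (simp add: add_ac)
      have 4: "fps_nth (hyper_fps (A + 1) B C) (Suc k) = W * ((C + x + 1) * (x + 2))"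
        unfolding hyper_fps_nth_Suc pochhammer_plus2 pochhammer_Suc[of B] pochhammer_Suc[of C]
          W_def x_def[symmetric]
        using nz by (simp add: mult_ac)
      have 5: "(A + 1) * fps_nth (hyper_fps (A + 2) B C) (Suc k) = W * ((A + 2 + x) * (C + x + 1) * (x + 2))"
        unfolding hyper_fps_nth_Suc pochhammer_Suc[of "A + 2"] pochhammer_Suc[of B] pochhammer_Suc[of C]
          W_def x_def[symmetric]
        using nz by (simp add: mult_ac)
      have "fps_nth ?F (Suc (Suc k)) = (C - A - 1) * fps_nth (hyper_fps A B C) (Suc (Suc k)) +
          ((2 * A + 2 - C) * fps_nth (hyper_fps (A + 1) B C) (Suc (Suc k)) + (B - A - 1) * fps_nth (hyper_fps (A + 1) B C) (Suc k))
          + ((A + 1) * fps_nth (hyper_fps (A + 2) B C) (Suc k) - (A + 1) * fps_nth (hyper_fps (A + 2) B C) (Suc (Suc k)))"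
        by (simp del: fps_hypergeo_nth)
      also have "\<dots> = W * ((C - A - 1) * (A * (B + x + 1)) + ((2 * A + 2 - C) * ((A + 2 + x) * (B + x + 1))
          + (B - A - 1) * ((C + x + 1) * (x + 2))) + ((A + 2 + x) * (C + x + 1) * (x + 2) - (A + 2 + x) * (A + 3 + x) * (B + x + 1)))"
        unfolding 1 2 3 4 5 by (simp add: algebra_simps)
      also have "\<dots> = 0" by algebra
      finally show ?thesis using \<open>n = _\<close> by simp
    qed
  qed
  moreover have "?f has_fps_expansion ?F"
    by (intro fps_expansion_intros E)
  ultimately have "?f has_fps_expansion 0" by simp
  moreover have "?f holomorphic_on slit_plane"
    by (intro holomorphic_intros E)
  ultimately have "?f (-1) = 0" 
    by (rule eq_zero_on_slit_plane) (rule minus_one_in_slit_plane)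
  then show ?thesis by (simp add: algebra_simps)
qed

text \<open>This is the hypergeometric differential equation, the first two derivatives being
  multiples of the series with all parameters raised by 1 and 2. The common factor
  \<open>A B\<close> is cancelled; comparing coefficients covers \<open>A B = 0\<close> as
  well.\<close>

lemma hyp2F1_contiguous_ABC:
  assumes C: "C \<notin> \<int>\<^sub>\<le>\<^sub>0"
  shows "C * (C + 1) * hyp2F1 A B C (-1) = (C + 1) * (C + A + B + 1) * hyp2F1 (A + 1) (B + 1) (C + 1) (-1)
    - 2 * (A + 1) * (B + 1) * hyp2F1 (A + 2) (B + 2) (C + 2) (-1)"
proof -
  note C1 = not_nonpos_Ints_plus1[OF C] and C2 = not_nonpos_Ints_plus2[OF C]
  note E = hyp2F1_has_fps_expansion[OF C] hyp2F1_holomorphic[OF C]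
    hyp2F1_has_fps_expansion[OF C1] hyp2F1_holomorphic[OF C1]
    hyp2F1_has_fps_expansion[OF C2] hyp2F1_holomorphic[OF C2]
  define c where "c = (A + 1) * (B + 1)"
  define d where "d = C * (C + 1)"
  define e where "e = (C + 1) * (A + B + 1)"
  let ?f = "\<lambda>z. (z * (c * hyp2F1 (A + 2) (B + 2) (C + 2) z) - z * (z * (c * hyp2F1 (A + 2) (B + 2) (C + 2) z)))
    + (d * hyp2F1 (A + 1) (B + 1) (C + 1) z - z * (e * hyp2F1 (A + 1) (B + 1) (C + 1) z)) - d * hyp2F1 A B C z"
  let ?K = "hyper_fps A B C" and ?L = "hyper_fps (A + 1) (B + 1) (C + 1)" and ?M = "hyper_fps (A + 2) (B + 2) (C + 2)"
  let ?F = "(fps_X * (fps_const c * ?M) - fps_X * (fps_X * (fps_const c * ?M)))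
    + (fps_const d * ?L - fps_X * (fps_const e * ?L)) - fps_const d * ?K"
  have "?F = 0"
  proof (rule fps_ext)
    fix n
    consider "n = 0" | "n = 1" | k where "n = Suc (Suc k)"
      by (metis One_nat_def not0_implies_Suc)
    then show "fps_nth ?F n = fps_nth 0 n"
    proof cases
      case 1
      then show ?thesis by simp
    next
      case 2
      have nz: "C \<noteq> 0" "C + 1 \<noteq> 0" using C C1 by auto
      have "fps_nth ?F 1 = c + d * ((A + 1) * (B + 1) / (C + 1)) - e - d * (A * B / C)"
        by simp
      also have "\<dots> = c + C * ((A + 1) * (B + 1)) - e - (C + 1) * (A * B)"
        unfolding d_def using nz by simp
      also have "\<dots> = 0"
        unfolding c_def e_def by algebra
      finally show ?thesis using 2 by simp
    next
      case 3
      define x :: complex where "x = of_nat k"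
      define W where "W = (A + 1) * (B + 1) * pochhammer (A + 2) k * pochhammer (B + 2) k
        / (pochhammer (C + 2) k * fact k * (C + 2 + x) * (x + 1) * (x + 2))"
      have nz: "C \<noteq> 0" "C + 1 \<noteq> 0" "C + 2 + x \<noteq> 0" "pochhammer (C + 2) k \<noteq> 0" "x + 1 \<noteq> 0" "x + 2 \<noteq> 0"
        using C C1 of_nat_neq_0[of k, where ?'a = complex] of_nat_neq_0[of "Suc k", where ?'a = complex]
          add_of_nat_neq_0[OF C2, of k] pochhammer_neq_0[OF C2]
        by (auto simp: x_def add_ac)
      have Suc_x: "of_nat (Suc k) = x + 1" by (simp add: x_def)
      have 1: "c * fps_nth ?M (Suc k) = W * ((A + 2 + x) * (B + 2 + x) * (x + 2))"
        unfolding hyper_fps_nth_Suc pochhammer_Suc c_def W_def x_def[symmetric] using nz by (simp add: mult_ac)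
      have 2: "c * fps_nth ?M k = W * ((C + 2 + x) * (x + 1) * (x + 2))"
        unfolding hyper_fps_nth c_def W_def using nz by (simp add: mult_ac)
      have 3: "(C + 1) * fps_nth ?L (Suc (Suc k)) = W * ((A + 2 + x) * (B + 2 + x))"
        unfolding hyper_fps_nth_Suc_Suc pochhammer_plus2 pochhammer_Suc[of "A + 2"] pochhammer_Suc[of "B + 2"] pochhammer_Suc[of "C + 2"] W_def Suc_x x_def[symmetric] using nz by (simp add: mult_ac)
      have 4: "(C + 1) * fps_nth ?L (Suc k) = W * ((C + 2 + x) * (x + 2))"
        unfolding hyper_fps_nth_Suc pochhammer_plus2 W_def x_def[symmetric] using nz by (simp add: mult_ac)
      have 5: "d * fps_nth ?K (Suc (Suc k)) = W * (A * B * (C + 2 + x))"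
        unfolding hyper_fps_nth_Suc_Suc pochhammer_rec[of A] pochhammer_rec[of B] pochhammer_rec[of C] pochhammer_plus2 W_def x_def[symmetric] d_def
        using nz by (simp add: mult_ac)
      have "fps_nth ?F (Suc (Suc k)) = (c * fps_nth ?M (Suc k) - c * fps_nth ?M k)
          + (C * ((C + 1) * fps_nth ?L (Suc (Suc k))) - (A + B + 1) * ((C + 1) * fps_nth ?L (Suc k))) - d * fps_nth ?K (Suc (Suc k))"
        by (simp add: d_def e_def mult_ac del: fps_hypergeo_nth)
      also have "\<dots> = W * ((A + 2 + x) * (B + 2 + x) * (x + 2) - (C + 2 + x) * (x + 1) * (x + 2)
         + (C * ((A + 2 + x) * (B + 2 + x)) - (A + B + 1) * ((C + 2 + x) * (x + 2))) - A * B * (C + 2 + x))"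
        unfolding 1 2 3 4 5 by (simp add: algebra_simps)
      also have "\<dots> = 0" by algebra
      finally show ?thesis using \<open>n = _\<close> by simp
    qed
  qed
  moreover have "?f has_fps_expansion ?F"
    by (intro fps_expansion_intros E)
  ultimately have "?f has_fps_expansion 0" by simp
  moreover have "?f holomorphic_on slit_plane"
    by (intro holomorphic_intros E)
  ultimately have "?f (-1) = 0" 
    by (rule eq_zero_on_slit_plane) (rule minus_one_in_slit_plane)
  then show ?thesis by (simp add: c_def d_def e_def algebra_simps)
qed

text \<open>For \<open>A = a - 1\<close>, \<open>B = b\<close> and \<open>C = a - b\<close> both
  series on the right satisfy Kummer's condition, so the value for \<open>m = 0\<close> reduces to
  two instances of Kummer's identity.\<close>

lemma hyp2F1_contiguous_AC:
  assumes C: "C \<notin> \<int>\<^sub>\<le>\<^sub>0"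
  shows "2 * C * hyp2F1 (A + 1) B C (-1) = C * hyp2F1 A B C (-1) + (C - B) * hyp2F1 (A + 1) B (C + 1) (-1)"
proof -
  note C1 = not_nonpos_Ints_plus1[OF C]
  note E = hyp2F1_has_fps_expansion[OF C] hyp2F1_holomorphic[OF C]
    hyp2F1_has_fps_expansion[OF C1] hyp2F1_holomorphic[OF C1]
  let ?f = "\<lambda>z. C * hyp2F1 (A + 1) B C z - z * (C * hyp2F1 (A + 1) B C z) - C * hyp2F1 A B C z
     + z * ((C - B) * hyp2F1 (A + 1) B (C + 1) z)"
  let ?K = "hyper_fps A B C" and ?L = "hyper_fps (A + 1) B C" and ?M = "hyper_fps (A + 1) B (C + 1)"
  let ?F = "fps_const C * ?L - fps_X * (fps_const C * ?L) - fps_const C * ?K + fps_X * (fps_const (C - B) * ?M)"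
  have "?F = 0"
  proof (rule fps_ext)
    fix n
    show "fps_nth ?F n = fps_nth 0 n"
    proof (cases n)
      case (Suc k)
      define x :: complex where "x = of_nat k"
      define W where "W = pochhammer (A + 1) k * pochhammer B k / (pochhammer C k * fact k * (C + x) * (x + 1))"
      have nz: "C \<noteq> 0" "C + x \<noteq> 0" "pochhammer C k \<noteq> 0" "x + 1 \<noteq> 0"
        using C of_nat_neq_0[of k, where ?'a = complex] add_of_nat_neq_0[OF C, of k] pochhammer_neq_0[OF C]
        by (auto simp: x_def add_ac)
      have 1: "fps_nth ?L (Suc k) = W * ((A + 1 + x) * (B + x))"
        unfolding hyper_fps_nth_Suc pochhammer_Suc W_def x_def[symmetric] by (simp only: frac_normalize)
      have 2: "fps_nth ?L k = W * ((C + x) * (x + 1))"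
        unfolding hyper_fps_nth W_def using nz by simp
      have 3: "fps_nth ?K (Suc k) = W * (A * (B + x))"
        unfolding hyper_fps_nth_Suc pochhammer_rec[of A] pochhammer_Suc[of B] pochhammer_Suc[of C] W_def x_def[symmetric]
        by (simp only: frac_normalize)
      have 4: "fps_nth ?M k = W * (C * (x + 1))"
        unfolding hyper_fps_nth pochhammer_plus1[OF nz(1)] W_def x_def[symmetric] using nz by (simp add: mult_ac)
      have "fps_nth ?F (Suc k) = C * fps_nth ?L (Suc k) - C * fps_nth ?L k - C * fps_nth ?K (Suc k) + (C - B) * fps_nth ?M k"
        by (simp del: fps_hypergeo_nth)
      also have "\<dots> = W * (C * ((A + 1 + x) * (B + x)) - C * ((C + x) * (x + 1)) - C * (A * (B + x)) + (C - B) * (C * (x + 1)))"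
        unfolding 1 2 3 4 by (simp add: algebra_simps)
      also have "\<dots> = 0" by algebra
      finally show ?thesis using Suc by simp
    qed simp
  qed
  moreover have "?f has_fps_expansion ?F"
    by (intro fps_expansion_intros E)
  ultimately have "?f has_fps_expansion 0" by simp
  moreover have "?f holomorphic_on slit_plane"
    by (intro holomorphic_intros E)
  ultimately have "?f (-1) = 0" 
    by (rule eq_zero_on_slit_plane) (rule minus_one_in_slit_plane)
  then show ?thesis by (simp add: algebra_simps)
qed

text \<open>
  In the next two relations the parameters satisfy Kummer's condition, and the two series differ by
  \<open>1 + z\<close> times a third hypergeometric series: this is why they are two-term relations at \<open>z = -1\<close> only.
\<close>

lemma hyp2F1_contiguous_BC:
  assumes C: "C \<notin> \<int>\<^sub>\<le>\<^sub>0" and C_eq: "C = A - B"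
  shows "2 * C * hyp2F1 A (B + 1) C (-1) = (A - 2 * B) * hyp2F1 A B (C + 1) (-1)"
proof -
  note C1 = not_nonpos_Ints_plus1[OF C]
  note E = hyp2F1_has_fps_expansion[OF C] hyp2F1_holomorphic[OF C]
    hyp2F1_has_fps_expansion[OF C1] hyp2F1_holomorphic[OF C1]
  let ?f = "\<lambda>z. 2 * C * hyp2F1 A (B + 1) C z - (A - 2 * B) * hyp2F1 A B (C + 1) z
     - (A * hyp2F1 (A + 1) (B + 1) (C + 1) z + z * (A * hyp2F1 (A + 1) (B + 1) (C + 1) z))"
  let ?K = "hyper_fps A (B + 1) C" and ?L = "hyper_fps A B (C + 1)" and ?M = "hyper_fps (A + 1) (B + 1) (C + 1)"
  let ?F = "fps_const (2 * C) * ?K - fps_const (A - 2 * B) * ?L - (fps_const A * ?M + fps_X * (fps_const A * ?M))"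
  have "?F = 0"
  proof (rule fps_ext)
    fix n
    show "fps_nth ?F n = fps_nth 0 n"
    proof (cases n)
      case (Suc k)
      define x :: complex where "x = of_nat k"
      define W where "W = A * pochhammer (A + 1) k * pochhammer (B + 1) k / (pochhammer (C + 1) k * fact k * (C + 1 + x) * (x + 1))"
      have nz: "C \<noteq> 0" "C + 1 + x \<noteq> 0" "pochhammer (C + 1) k \<noteq> 0" "x + 1 \<noteq> 0"
        using C of_nat_neq_0[of k, where ?'a = complex] add_of_nat_neq_0[OF C1, of k] pochhammer_neq_0[OF C1]
        by (auto simp: x_def add_ac)
      have 1: "C * fps_nth ?K (Suc k) = W * ((B + 1 + x) * (C + 1 + x))"
        unfolding hyper_fps_nth_Suc pochhammer_rec[of A] pochhammer_rec[of C] pochhammer_Suc[of "B + 1"] W_def x_def[symmetric]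
        using nz by (simp add: mult_ac)
      have 2: "fps_nth ?L (Suc k) = W * B"
        unfolding hyper_fps_nth_Suc pochhammer_rec[of A] pochhammer_rec[of B] pochhammer_Suc[of "C + 1"] W_def x_def[symmetric]
        by (simp only: frac_normalize)
      have 3: "A * fps_nth ?M (Suc k) = W * ((A + 1 + x) * (B + 1 + x))"
        unfolding hyper_fps_nth_Suc pochhammer_Suc W_def x_def[symmetric]
        by (simp only: frac_normalize)
      have 4: "A * fps_nth ?M k = W * ((C + 1 + x) * (x + 1))"
        unfolding hyper_fps_nth W_def x_def[symmetric] using nz by (simp add: mult_ac)
      have "fps_nth ?F (Suc k) = 2 * (C * fps_nth ?K (Suc k)) - (A - 2 * B) * fps_nth ?L (Suc k)
          - (A * fps_nth ?M (Suc k) + A * fps_nth ?M k)"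
        by (simp del: fps_hypergeo_nth)
      also have "\<dots> = W * (2 * ((B + 1 + x) * (C + 1 + x)) - (A - 2 * B) * B
          - ((A + 1 + x) * (B + 1 + x) + (C + 1 + x) * (x + 1)))"
        unfolding 1 2 3 4 by (simp add: algebra_simps)
      also have "\<dots> = 0" unfolding C_eq by algebra
      finally show ?thesis using Suc by simp
    qed (simp add: C_eq)
  qed
  moreover have "?f has_fps_expansion ?F"
    by (intro fps_expansion_intros E)
  ultimately have "?f has_fps_expansion 0" by simp
  moreover have "?f holomorphic_on slit_plane"
    by (intro holomorphic_intros E)
  ultimately have "?f (-1) = 0" 
    by (rule eq_zero_on_slit_plane) (rule minus_one_in_slit_plane)
  then show ?thesis by (simp add: algebra_simps)
qed

lemma hyp2F1_contiguous_A2C2: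
  assumes C: "C \<notin> \<int>\<^sub>\<le>\<^sub>0" and C_eq: "C = 1 + A - B"
  shows "C * (C + 1) * hyp2F1 A B C (-1) = (A + 1) * (A + 2 - 2 * B) * hyp2F1 (A + 2) B (C + 2) (-1)"
proof -
  note C1 = not_nonpos_Ints_plus1[OF C] and C2 = not_nonpos_Ints_plus2[OF C]
  note E = hyp2F1_has_fps_expansion[OF C] hyp2F1_holomorphic[OF C]
    hyp2F1_has_fps_expansion[OF C2] hyp2F1_holomorphic[OF C2]
  define d where "d = C * (C + 1)"
  define e where "e = (A + 1) * (A + 2 - 2 * B)"
  define b where "b = B * (B - 1)"
  let ?f = "\<lambda>z. d * hyp2F1 A B C z - e * hyp2F1 (A + 2) B (C + 2) z
     - (b * hyp2F1 (A + 1) (B + 1) (C + 2) z + z * (b * hyp2F1 (A + 1) (B + 1) (C + 2) z))"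
  let ?K = "hyper_fps A B C" and ?L = "hyper_fps (A + 2) B (C + 2)" and ?M = "hyper_fps (A + 1) (B + 1) (C + 2)"
  let ?F = "fps_const d * ?K - fps_const e * ?L - (fps_const b * ?M + fps_X * (fps_const b * ?M))"
  have "?F = 0"
  proof (rule fps_ext)
    fix n
    show "fps_nth ?F n = fps_nth 0 n"
    proof (cases n)
      case 0
      have "d - e - b = 0" unfolding d_def e_def b_def C_eq by algebra
      then show ?thesis using 0 by simp
    next
      case (Suc k)
      define x :: complex where "x = of_nat k"
      define W where "W = B * (C + 1) * pochhammer (A + 1) k * pochhammer (B + 1) k
        / (pochhammer (C + 1) k * fact k * (C + 1 + x) * (C + 2 + x) * (x + 1))"
      have nz: "C \<noteq> 0" "C + 1 \<noteq> 0" "C + 1 + x \<noteq> 0" "C + 2 + x \<noteq> 0" "pochhammer (C + 1) k \<noteq> 0" "x + 1 \<noteq> 0"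
        using C C1 of_nat_neq_0[of k, where ?'a = complex] add_of_nat_neq_0[OF C1, of k]
          add_of_nat_neq_0[OF C2, of k] pochhammer_neq_0[OF C1]
        by (auto simp: x_def add_ac)
      have poch_C: "pochhammer (C + 2) k = pochhammer (C + 1) k * (C + 1 + x) / (C + 1)"
        using pochhammer_plus1[OF nz(2), of k] by (simp add: x_def add.assoc)
      have poch_A: "(A + 1) * pochhammer (A + 2) (Suc k) = pochhammer (A + 1) k * (A + 1 + x) * (A + 2 + x)"
        unfolding pochhammer_plus2[symmetric] unfolding pochhammer_Suc x_def by (simp add: add_ac)
      have 1: "d * fps_nth ?K (Suc k) = W * (A * (C + 1 + x) * (C + 2 + x))"
        unfolding hyper_fps_nth_Suc pochhammer_rec W_def d_def x_def[symmetric]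
        using nz by (simp add: mult_ac)
      have "(A + 1) * fps_nth ?L (Suc k) = (A + 1) * pochhammer (A + 2) (Suc k) * pochhammer B (Suc k) /
          (pochhammer (C + 2) (Suc k) * (fact k * (x + 1)))"
        unfolding hyper_fps_nth_Suc x_def by (simp only: frac_normalize)
      also have "\<dots> = W * ((A + 1 + x) * (A + 2 + x))"
        unfolding poch_A pochhammer_rec[of B] pochhammer_Suc[of "C + 2"] poch_C W_def x_def[symmetric]
        using nz by (simp add: mult_ac)
      finally have 2: "(A + 1) * fps_nth ?L (Suc k) = W * ((A + 1 + x) * (A + 2 + x))" .
      have 3: "B * fps_nth ?M (Suc k) = W * ((A + 1 + x) * (B + 1 + x))"
        unfolding hyper_fps_nth_Suc pochhammer_Suc poch_C W_def x_def[symmetric]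
        using nz by (simp add: mult_ac)
      have 4: "B * fps_nth ?M k = W * ((C + 2 + x) * (x + 1))"
        unfolding hyper_fps_nth poch_C W_def x_def[symmetric] using nz by (simp add: mult_ac)
      have "fps_nth ?F (Suc k) = d * fps_nth ?K (Suc k) - (A + 2 - 2 * B) * ((A + 1) * fps_nth ?L (Suc k))
          - ((B - 1) * (B * fps_nth ?M (Suc k)) + (B - 1) * (B * fps_nth ?M k))"
        by (simp add: e_def b_def mult_ac del: fps_hypergeo_nth)
      also have "\<dots> = W * (A * (C + 1 + x) * (C + 2 + x) - (A + 2 - 2 * B) * ((A + 1 + x) * (A + 2 + x))
          - ((B - 1) * ((A + 1 + x) * (B + 1 + x)) + (B - 1) * ((C + 2 + x) * (x + 1))))"
        unfolding 1 2 3 4 by (simp add: algebra_simps)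
      also have "\<dots> = 0" unfolding C_eq by algebra
      finally show ?thesis using Suc by simp
    qed
  qed
  moreover have "?f has_fps_expansion ?F"
    by (intro fps_expansion_intros E)
  ultimately have "?f has_fps_expansion 0" by simp
  moreover have "?f holomorphic_on slit_plane"
    by (intro holomorphic_intros E)
  ultimately have "?f (-1) = 0" 
    by (rule eq_zero_on_slit_plane) (rule minus_one_in_slit_plane)
  then show ?thesis by (simp add: d_def e_def algebra_simps)
qed

section \<open>Kummer's identity\<close>

lemma tendsto_pochhammer_shift_quotient:
  "(\<lambda>N. pochhammer (x + of_nat N) k / pochhammer (y + of_nat N) k) \<longlonglongrightarrow> 1" for x y :: complex
proof (induction k)
  case (Suc k)
  have "(\<lambda>N. pochhammer (x + of_nat N) k / pochhammer (y + of_nat N) k *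
      ((x + of_nat k + of_nat N) / (y + of_nat k + of_nat N))) \<longlonglongrightarrow> 1 * 1"
    by (intro tendsto_mult Suc tendsto_shift_quotient)
  then show ?case
    by (simp add: pochhammer_Suc add_ac)
qed auto

text \<open>Absolute convergence on the unit circle makes the sum continuous on the closed disc, so
  \<open>f\<close> and the series have the same limit along real points tending to -1 from
  inside.\<close>

lemma Abel_sums_at_minus_one:
  fixes f :: "complex \<Rightarrow> complex"
  assumes c: "summable (\<lambda>k. norm (c k))"
    and f: "\<And>z. z \<in> ball 0 1 \<Longrightarrow> f z = (\<Sum>k. c k * z ^ k)"
    and cont: "isCont f (-1)"
  shows "f (-1) = (\<Sum>k. c k * (-1) ^ k)"
proof -
  define g where "g = (\<lambda>z. \<Sum>k. c k * z ^ k)"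
  define u :: "nat \<Rightarrow> complex" where "u = (\<lambda>n. - (1 - of_real (1 / (real n + 1))))"
  have "continuous_on (cball 0 1) g"
  proof (rule uniform_limit_theorem)
    show "uniform_limit (cball 0 1) (\<lambda>n z. \<Sum>k<n. c k * z ^ k) g sequentially"
      unfolding g_def
    proof (rule Weierstrass_m_test[OF _ c])
      fix n z assume "z \<in> cball (0::complex) 1"
      then show "norm (c n * z ^ n) \<le> norm (c n)"
        by (simp add: norm_mult norm_power mult_left_le power_le_one)
    qed
  qed (auto intro!: always_eventually continuous_intros)
  moreover have u: "u \<longlonglongrightarrow> -1"
  proof -
    have "(\<lambda>n. - (1 - complex_of_real (1 / (real n + 1)))) \<longlonglongrightarrow> - (1 - of_real 0)"
      by (intro tendsto_intros) real_asymp
    then show ?thesis by (simp add: u_def)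
  qed
  moreover have u_ball: "u n \<in> ball 0 1" for n
  proof -
    have "u n = of_real (- (1 - 1 / (real n + 1)))" by (simp add: u_def)
    then have "norm (u n) = \<bar>1 - 1 / (real n + 1)\<bar>" by (simp only: norm_of_real abs_minus)
    then show ?thesis by simp
  qed
  ultimately have "(\<lambda>n. g (u n)) \<longlonglongrightarrow> g (-1)"
    by (intro continuous_on_tendsto_compose[of "cball 0 1" g u]) (auto intro!: always_eventually less_imp_le)
  moreover have "(\<lambda>n. f (u n)) \<longlonglongrightarrow> f (-1)"
    using cont u by (rule isCont_tendsto_compose)
  moreover have "f (u n) = g (u n)" for n
    using f[OF u_ball] by (simp add: g_def)
  ultimately show ?thesis
    unfolding g_def using LIMSEQ_unique by simp
qed

text \<open>By Gauss' product for the reciprocal Gamma function the terms are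
  \<open>O(k^(Re b - 1))\<close>.\<close>

lemma summable_pochhammer_fact:
  assumes "Re b < 0"
  shows "summable (\<lambda>k. norm (pochhammer b k / fact k))"
proof -
  have "Bseq (rGamma_series b)"
    by (rule convergent_imp_Bseq) (auto intro: convergentI rGamma_series_LIMSEQ)
  then obtain M where M: "M > 0" "\<And>n. norm (rGamma_series b n) \<le> M"
    by (auto simp: Bseq_def)
  have "summable (\<lambda>n. M * real n powr (Re b - 1))"
    using assms by (intro summable_mult) (simp add: summable_real_powr_iff)
  moreover have "norm (pochhammer b (Suc n) / fact (Suc n)) \<le> M * real n powr (Re b - 1)" if "n \<ge> 1" for n
  proof -
    have "pochhammer b (Suc n) = rGamma_series b n * (fact n * exp (b * of_real (ln (of_nat n))))"
      by (simp add: rGamma_series_def)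
    then have "norm (pochhammer b (Suc n) / fact (Suc n)) = norm (rGamma_series b n) * real n powr Re b / real (Suc n)"
      using that by (simp add: norm_mult norm_divide powr_def mult_ac del: of_nat_Suc) 
    also have "\<dots> \<le> M * real n powr Re b / real n"
      using M(1) M(2)[of n] that by (intro frac_le mult_right_mono) auto
    also have "\<dots> = M * real n powr (Re b - 1)"
      using that by (simp add: powr_diff)
    finally show ?thesis .
  qed
  then have "\<forall>n\<ge>1. norm (norm (pochhammer b (Suc n) / fact (Suc n))) \<le> M * real n powr (Re b - 1)"
    by simp
  ultimately have "summable (\<lambda>n. norm (pochhammer b (Suc n) / fact (Suc n)))"
    by (rule summable_comparison_test[rotated, OF _ exI])
  then show ?thesis by (subst (asm) summable_Suc_iff)
qed

lemma norm_pochhammer_le: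
  fixes x y :: complex
  assumes "\<And>j. norm (x + of_nat j) \<le> norm (y + of_nat j)"
  shows "norm (pochhammer x k) \<le> norm (pochhammer y k)"
  by (induction k) (auto simp: pochhammer_Suc norm_mult intro!: mult_mono assms)

lemma Re_less_minus_nonpos: "Re a > 0 \<Longrightarrow> a \<notin> \<int>\<^sub>\<le>\<^sub>0"
  by (auto elim!: nonpos_Ints_cases)

text \<open>The quotients of \<open>pochhammer (a + N - 1) k\<close> by
  \<open>pochhammer (a - b + N) k\<close> tend to 1 and leave the binomial series of
  \<open>(1 - z)^(-b)\<close> at -1. For \<open>Re b < 0\<close> Tannery's theorem applies, with
  dominating terms \<open>norm (pochhammer b k / fact k)\<close>.\<close>

lemma hyp2F1_at_minus_one_limit:
  assumes b: "Re b < 0"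
  shows "(\<lambda>N. hyp2F1 (a + of_nat N - 1) b (a - b + of_nat N) (-1)) \<longlonglongrightarrow> 2 powr (-b)"
proof -
  define c where "c = (\<lambda>k N. fps_nth (hyper_fps (a + of_nat N - 1) b (a - b + of_nat N)) k * (-1) ^ k)"
  note sb = summable_pochhammer_fact[OF b]
  \<comment> \<open>This size of \<open>N0\<close> makes \<open>X \<ge> (Im a)^2\<close> below,
    hence \<open>X^2 + (Im a)^2 \<le> (X + 1)^2\<close>; and \<open>X + 1\<close> is at most the
    real part of \<open>a - b + N + j\<close> because \<open>Re b < 0\<close>.\<close>
  obtain N0 :: nat where N0: "norm a + (Im a)\<^sup>2 + 1 \<le> N0"
    using real_arch_simple by blast
  have large: "a - b + of_nat N \<notin> \<int>\<^sub>\<le>\<^sub>0"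
    "norm (pochhammer (a + of_nat N - 1) k) \<le> norm (pochhammer (a - b + of_nat N) k)" if "N \<ge> N0" for N k
  proof -
    have Re: "Re a + real N - 1 \<ge> (Im a)\<^sup>2"
      using N0 that abs_Re_le_cmod[of a] by linarith
    have sq: "(Im a)\<^sup>2 \<ge> 0" by simp
    then have "Re a + real N > 0" using Re by linarith
    then show "a - b + of_nat N \<notin> \<int>\<^sub>\<le>\<^sub>0"
      using b by (intro Re_less_minus_nonpos) simp
    show "norm (pochhammer (a + of_nat N - 1) k) \<le> norm (pochhammer (a - b + of_nat N) k)"
    proof (rule norm_pochhammer_le)
      fix j
      define X where "X = Re a + real N - 1 + real j"
      have X: "X \<ge> (Im a)\<^sup>2" "X \<ge> 0" unfolding X_def using Re sq by linarith+
      have "norm (a + of_nat N - 1 + of_nat j) = sqrt (X\<^sup>2 + (Im a)\<^sup>2)"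
        by (simp add: cmod_def X_def add_ac diff_add_eq)
      also have "\<dots> \<le> sqrt ((X + 1)\<^sup>2)"
        using X by (intro real_sqrt_le_mono) (simp add: power2_eq_square algebra_simps)
      also have "\<dots> = X + 1" using X by simp
      also have "\<dots> \<le> Re (a - b + of_nat N + of_nat j)"
        using b by (simp add: X_def)
      also have "\<dots> \<le> norm (a - b + of_nat N + of_nat j)"
        by (rule complex_Re_le_cmod)
      finally show "norm (a + of_nat N - 1 + of_nat j) \<le> norm (a - b + of_nat N + of_nat j)" .
    qed
  qed
  have bound: "norm (fps_nth (hyper_fps (a + of_nat N - 1) b (a - b + of_nat N)) k) \<le> norm (pochhammer b k / fact k)"
    if N: "N \<ge> N0" for N k
  proof -
    have "norm (pochhammer (a + of_nat N - 1) k / pochhammer (a - b + of_nat N) k) \<le> 1"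
      using large(2)[OF N, of k] pochhammer_neq_0[OF large(1)[OF N], of k] by (simp add: norm_divide)
    then have "norm (pochhammer (a + of_nat N - 1) k / pochhammer (a - b + of_nat N) k) * norm (pochhammer b k / fact k)
       \<le> 1 * norm (pochhammer b k / fact k)"
      by (rule mult_right_mono) simp
    then show ?thesis by (simp add: norm_mult norm_divide)
  qed
  have series: "hyp2F1 (a + of_nat N - 1) b (a - b + of_nat N) (-1) = (\<Sum>k. c k N)" if N: "N \<ge> N0" for N
    unfolding c_def
  proof (rule Abel_sums_at_minus_one)
    show "summable (\<lambda>k. norm (fps_nth (hyper_fps (a + of_nat N - 1) b (a - b + of_nat N)) k))"
      using bound[OF N] by (intro summable_comparison_test'[OF sb, of 0]) (simp del: fps_hypergeo_nth)
    show "isCont (hyp2F1 (a + of_nat N - 1) b (a - b + of_nat N)) (- 1)"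
      using holomorphic_on_imp_continuous_on[OF hyp2F1_holomorphic[OF large(1)[OF N]]]
        open_slit_plane minus_one_in_slit_plane by (simp add: continuous_on_eq_continuous_at)
  qed (use hyp2F1_eval_fps[OF large(1)[OF N]] in \<open>simp add: eval_fps_def del: fps_hypergeo_nth\<close>)
  have "(\<lambda>N. \<Sum>k. c k N) \<longlonglongrightarrow> (\<Sum>k. pochhammer b k / fact k * (-1) ^ k)"
  proof (rule tannerys_theorem[THEN conjunct2, THEN conjunct2])
    show "c k \<longlonglongrightarrow> pochhammer b k / fact k * (-1) ^ k" for k
    proof -
      have "(\<lambda>N. pochhammer (a - 1 + of_nat N) k / pochhammer (a - b + of_nat N) k * (pochhammer b k / fact k * (-1) ^ k))
         \<longlonglongrightarrow> 1 * (pochhammer b k / fact k * (-1) ^ k)"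
        by (intro tendsto_mult tendsto_pochhammer_shift_quotient tendsto_const)
      then show ?thesis by (simp add: c_def algebra_simps)
    qed
    have "eventually (\<lambda>N. N \<ge> N0) sequentially" by (rule eventually_ge_at_top)
    then have "eventually (\<lambda>x. snd x \<ge> N0) (at_top \<times>\<^sub>F sequentially)"
      by (rule eventually_compose_filterlim[OF _ filterlim_snd])
    then show "eventually (\<lambda>(k, N). norm (c k N) \<le> norm (pochhammer b k / fact k)) (at_top \<times>\<^sub>F sequentially)"
      by eventually_elim (use bound in \<open>auto simp: c_def norm_mult norm_power simp del: fps_hypergeo_nth\<close>)
  qed (use sb in auto)
  moreover have "(\<Sum>k. pochhammer b k / fact k * (-1) ^ k) = 2 powr (-b)"
  proof -
    have "(1 - (-1)) powr (-b) = (\<Sum>k. pochhammer b k / fact k * (-1) ^ k)"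
    proof (rule Abel_sums_at_minus_one[OF sb, where f = "\<lambda>z. (1 - z) powr (-b)"])
      fix z :: complex assume "z \<in> ball 0 1"
      then have "(\<lambda>n. (-b gchoose n) * (-z) ^ n) sums (1 + (-z)) powr (-b)"
        by (intro gen_binomial_complex) simp
      then show "(1 - z) powr (-b) = (\<Sum>k. pochhammer b k / fact k * z ^ k)"
        by (simp add: sums_iff gbinomial_pochhammer power_minus[of z] mult_ac)
    next
      show "isCont (\<lambda>z. (1 - z) powr (-b)) (-1)"
        by (intro continuous_intros) auto
    qed
    then show ?thesis by simp
  qed
  moreover have "eventually (\<lambda>N. (\<Sum>k. c k N) = hyp2F1 (a + of_nat N - 1) b (a - b + of_nat N) (-1)) sequentially"
    using eventually_ge_at_top[of N0] by eventually_elim (simp add: series)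
  ultimately show ?thesis
    using tendsto_cong by force
qed


text \<open>Gauss' product in numerator and denominator: the factorials cancel, and the powers of
  \<open>N\<close> cancel because the arguments have equal sums.\<close>

lemma rGamma_quotient_limit:
  fixes x x' y y' :: complex
  assumes sum: "x + x' = y + y'" and nz: "x \<notin> \<int>\<^sub>\<le>\<^sub>0" "x' \<notin> \<int>\<^sub>\<le>\<^sub>0"
  shows "(\<lambda>N. pochhammer y N * pochhammer y' N / (pochhammer x N * pochhammer x' N))
           \<longlonglongrightarrow> Gamma x * Gamma x' * rGamma y * rGamma y'"
proof -
  have "(\<lambda>N. rGamma_series y N * rGamma_series y' N / (rGamma_series x N * rGamma_series x' N))
      \<longlonglongrightarrow> rGamma y * rGamma y' / (rGamma x * rGamma x')"
    by (intro tendsto_intros) (use nz in \<open>auto simp: rGamma_eq_zero_iff\<close>)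
  moreover have "rGamma_series y N * rGamma_series y' N / (rGamma_series x N * rGamma_series x' N) =
      pochhammer y (Suc N) * pochhammer y' (Suc N) / (pochhammer x (Suc N) * pochhammer x' (Suc N))" for N
  proof -
    define L :: complex where "L = of_real (ln (real N))"
    define f :: complex where "f = fact N"
    have f: "f \<noteq> 0" by (simp add: f_def)
    have e: "exp (y * L) * exp (y' * L) = exp (x * L) * exp (x' * L)"
      by (simp add: sum flip: exp_add distrib_right)
    have "rGamma_series y N * rGamma_series y' N = pochhammer y (Suc N) * pochhammer y' (Suc N) / (f * f * (exp (y * L) * exp (y' * L)))"
      by (simp add: rGamma_series_def L_def[symmetric] f_def[symmetric] mult_ac)
    moreover have "rGamma_series x N * rGamma_series x' N = pochhammer x (Suc N) * pochhammer x' (Suc N) / (f * f * (exp (y * L) * exp (y' * L)))"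
      unfolding e by (simp add: rGamma_series_def L_def[symmetric] f_def[symmetric] mult_ac)
    moreover have "f * f * (exp (y * L) * exp (y' * L)) \<noteq> 0" using f by simp
    ultimately show ?thesis by simp
  qed
  ultimately have "(\<lambda>N. pochhammer y (Suc N) * pochhammer y' (Suc N) / (pochhammer x (Suc N) * pochhammer x' (Suc N)))
      \<longlonglongrightarrow> Gamma x * Gamma x' * rGamma y * rGamma y'"
    by (simp add: rGamma_inverse_Gamma field_simps)
  then show ?thesis by (rule LIMSEQ_imp_Suc)
qed

lemma not_nonpos_Ints_half:
  fixes x :: complex
  assumes "x \<notin> \<int>\<^sub>\<le>\<^sub>0"
  shows "x / 2 \<notin> \<int>\<^sub>\<le>\<^sub>0" "(x + 1) / 2 \<notin> \<int>\<^sub>\<le>\<^sub>0"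
proof -
  show "x / 2 \<notin> \<int>\<^sub>\<le>\<^sub>0"
  proof
    assume "x / 2 \<in> \<int>\<^sub>\<le>\<^sub>0"
    then obtain n where "x / 2 = - of_nat n" by (elim nonpos_Ints_cases')
    then have "x = - of_nat (2 * n)" by (simp add: field_simps)
    then show False using assms minus_of_nat_in_nonpos_Ints by metis
  qed
  show "(x + 1) / 2 \<notin> \<int>\<^sub>\<le>\<^sub>0"
  proof
    assume "(x + 1) / 2 \<in> \<int>\<^sub>\<le>\<^sub>0"
    then obtain n where "(x + 1) / 2 = - of_nat n" by (elim nonpos_Ints_cases')
    then have "2 * ((x + 1) / 2) - 1 = - of_nat (2 * n + 1)" by simp
    then have "x = - of_nat (2 * n + 1)" by simp
    then show False using assms minus_of_nat_in_nonpos_Ints by metis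
  qed
qed

lemma Kummer_left_half_plane:
  assumes a: "a \<notin> \<int>\<^sub>\<le>\<^sub>0" and ab: "a - b \<notin> \<int>\<^sub>\<le>\<^sub>0" and b: "Re b < 0"
  shows "hyp2F1 (a - 1) b (a - b) (-1) = Gamma (a - b) * Gamma ((a + 1) / 2) * rGamma a * rGamma ((a + 1) / 2 - b)"
proof -
  define K where "K = (\<lambda>N. hyp2F1 (a + of_nat (2 * N) - 1) b (a - b + of_nat (2 * N)) (-1))"
  \<comment> \<open>Chosen so that in the relation shifting \<open>A\<close> and \<open>C\<close> by
    2 the factors \<open>C (C + 1) / 4\<close> and \<open>(A + 1) (A + 2 - 2 b) / 4\<close> are
    products of two terms of the form constant plus \<open>N\<close>, which accumulate to Pochhammer
    symbols.\<close>
  define x x' y y' where "x = (a - b) / 2" and "x' = (a - b + 1) / 2" and "y = a / 2" and "y' = (a + 1) / 2 - b"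
  have nz: "x \<notin> \<int>\<^sub>\<le>\<^sub>0" "x' \<notin> \<int>\<^sub>\<le>\<^sub>0" "y \<notin> \<int>\<^sub>\<le>\<^sub>0" "(a + 1) / 2 \<notin> \<int>\<^sub>\<le>\<^sub>0"
    using not_nonpos_Ints_half[OF ab] not_nonpos_Ints_half[OF a] by (auto simp: x_def x'_def y_def)
  have step: "(x + of_nat N) * (x' + of_nat N) * K N = (y + of_nat N) * (y' + of_nat N) * K (Suc N)" for N
  proof -
    define A C where "A = a + of_nat (2 * N) - 1" and "C = a - b + of_nat (2 * N)"
    have C: "C \<notin> \<int>\<^sub>\<le>\<^sub>0"
      unfolding C_def by (rule not_nonpos_Ints_plus_of_nat[OF ab])
    have C_eq: "C = 1 + A - b" by (simp add: A_def C_def)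
    have half: "(A + 2) / 2 - b = (A + 2 - 2 * b) / 2" by (simp add: diff_divide_distrib)
    from hyp2F1_contiguous_A2C2[OF C C_eq]
    have "C / 2 * ((C + 1) / 2) * hyp2F1 A b C (-1) = (A + 1) / 2 * ((A + 2) / 2 - b) * hyp2F1 (A + 2) b (C + 2) (-1)"
      unfolding half by simp
    moreover have "C / 2 = x + of_nat N" "(C + 1) / 2 = x' + of_nat N" "(A + 1) / 2 = y + of_nat N"
      "(A + 2) / 2 - b = y' + of_nat N"
      by (simp_all add: A_def C_def x_def x'_def y_def y'_def add_divide_distrib diff_divide_distrib)
    moreover have "hyp2F1 A b C (-1) = K N" "hyp2F1 (A + 2) b (C + 2) (-1) = K (Suc N)"
    proof -
      have "A + 2 = a + of_nat (2 * Suc N) - 1" "C + 2 = a - b + of_nat (2 * Suc N)"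
        by (simp_all add: A_def C_def)
      then show "hyp2F1 (A + 2) b (C + 2) (-1) = K (Suc N)" by (simp only: K_def)
    qed (simp add: A_def C_def K_def)
    ultimately show ?thesis by simp
  qed
  have "pochhammer x N * pochhammer x' N * K 0 = pochhammer y N * pochhammer y' N * K N" for N
  proof (induction N)
    case (Suc N)
    have "pochhammer x (Suc N) * pochhammer x' (Suc N) * K 0
        = (x + of_nat N) * (x' + of_nat N) * (pochhammer x N * pochhammer x' N * K 0)"
      by (simp add: pochhammer_Suc mult_ac)
    also have "\<dots> = pochhammer y N * pochhammer y' N * ((x + of_nat N) * (x' + of_nat N) * K N)"
      unfolding Suc by (simp add: mult_ac)
    also have "\<dots> = pochhammer y (Suc N) * pochhammer y' (Suc N) * K (Suc N)"
      unfolding step by (simp add: pochhammer_Suc mult_ac)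
    finally show ?case .
  qed simp
  then have "K 0 = pochhammer y N * pochhammer y' N / (pochhammer x N * pochhammer x' N) * K N" for N
    using pochhammer_neq_0[OF nz(1), of N] pochhammer_neq_0[OF nz(2), of N] by (simp add: field_simps)
  moreover have "(\<lambda>N. pochhammer y N * pochhammer y' N / (pochhammer x N * pochhammer x' N) * K N)
      \<longlonglongrightarrow> Gamma x * Gamma x' * rGamma y * rGamma y' * 2 powr (-b)"
  proof (intro tendsto_mult[OF rGamma_quotient_limit[OF _ nz(1,2)]])
    show "x + x' = y + y'" by (simp add: x_def x'_def y_def y'_def field_simps)
    show "K \<longlonglongrightarrow> 2 powr (-b)"
      unfolding K_def
      using filterlim_compose[OF hyp2F1_at_minus_one_limit[OF b, of a], of "\<lambda>N. 2 * N" sequentially]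
        mult_nat_left_at_top[of 2] by simp
  qed
  ultimately have "(\<lambda>N. K 0) \<longlonglongrightarrow> Gamma x * Gamma x' * rGamma y * rGamma y' * 2 powr (-b)"
    by simp
  then have K0: "K 0 = Gamma x * Gamma x' * rGamma y * rGamma y' * 2 powr (-b)"
    using LIMSEQ_unique tendsto_const by blast
  define S where "S = complex_of_real (sqrt pi)"
  \<comment> \<open>Legendre duplication turns the half arguments into \<open>Gamma (a - b)\<close>
    and \<open>Gamma a\<close>; the two powers of 2 it produces differ exactly by the factor
    \<open>2 powr (-b)\<close> found in the limit.\<close>
  have G1: "Gamma x * Gamma x' = exp ((1 - (a - b)) * of_real (ln 2)) * S * Gamma (a - b)"
    using Gamma_legendre_duplication[of x] nz by (simp add: x_def x'_def S_def add_divide_distrib)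
  have G2: "Gamma y * Gamma ((a + 1) / 2) = exp ((1 - a) * of_real (ln 2)) * S * Gamma a"
    using Gamma_legendre_duplication[of y] nz by (simp add: y_def S_def add_divide_distrib)
  have pw: "exp ((1 - (a - b)) * of_real (ln 2)) * 2 powr (-b) = exp ((1 - a) * of_real (ln 2))"
  proof -
    have "2 powr (-b) = exp (-b * of_real (ln 2))"
      using Ln_of_real[of 2] by (simp add: powr_def)
    then show ?thesis by (simp add: ring_distribs flip: exp_add)
  qed
  have Gnz: "Gamma a \<noteq> 0" "Gamma y \<noteq> 0"
    using a nz by (auto simp: Gamma_eq_zero_iff)
  have "Gamma x * Gamma x' * rGamma y * 2 powr (-b)
      = exp ((1 - (a - b)) * of_real (ln 2)) * 2 powr (-b) * S * Gamma (a - b) * rGamma y"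
    unfolding G1 by (simp only: mult_ac)
  also have "\<dots> = exp ((1 - a) * of_real (ln 2)) * S * Gamma a * Gamma (a - b) * rGamma y * rGamma a"
    unfolding pw using Gnz(1) by (simp add: rGamma_inverse_Gamma)
  also have "\<dots> = Gamma (a - b) * Gamma ((a + 1) / 2) * rGamma a"
    unfolding G2[symmetric] using Gnz(2) by (simp add: rGamma_inverse_Gamma)
  finally have "Gamma x * Gamma x' * rGamma y * 2 powr (-b) = Gamma (a - b) * Gamma ((a + 1) / 2) * rGamma a" .
  then show ?thesis
    using K0 by (simp add: K_def y'_def mult_ac)
qed

text \<open>Induction over \<open>n\<close> with \<open>Re b < n\<close>: the relation shifting
  \<open>B\<close> and \<open>C\<close> in opposite directions leads from \<open>b\<close> to
  \<open>b - 1\<close>. With \<open>rGamma\<close>, the functional equation absorbs the factor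
  \<open>(a + 1) / 2 - b\<close> even where it vanishes.\<close>

theorem Kummer:
  assumes a: "a \<notin> \<int>\<^sub>\<le>\<^sub>0" and ab: "a - b \<notin> \<int>\<^sub>\<le>\<^sub>0"
  shows "hyp2F1 (a - 1) b (a - b) (-1) = Gamma (a - b) * Gamma ((a + 1) / 2) * rGamma a * rGamma ((a + 1) / 2 - b)"
proof -
  obtain n :: nat where "Re b < n" using reals_Archimedean2 by blast
  then show ?thesis using ab
  proof (induction n arbitrary: b)
    case 0
    then show ?case by (intro Kummer_left_half_plane a) auto
  next
    case (Suc n)
    have ab1: "a - b + 1 \<notin> \<int>\<^sub>\<le>\<^sub>0" using not_nonpos_Ints_plus1[OF Suc.prems(2)] .
    have nz: "a - b \<noteq> 0" using Suc.prems(2) by auto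
    have half: "(a + 1) / 2 - b = (a + 1 - 2 * b) / 2" by (simp add: diff_divide_distrib)
    have IH: "hyp2F1 (a - 1) (b - 1) (a - b + 1) (-1)
      = Gamma (a - b + 1) * Gamma ((a + 1) / 2) * rGamma a * rGamma ((a + 1) / 2 - b + 1)"
      using Suc.IH[of "b - 1"] Suc.prems(1) ab1 by (simp add: algebra_simps)
    have "2 * (a - b) * hyp2F1 (a - 1) b (a - b) (-1) = (a + 1 - 2 * b) * hyp2F1 (a - 1) (b - 1) (a - b + 1) (-1)"
      using hyp2F1_contiguous_BC[OF Suc.prems(2), of "a - 1" "b - 1"] by (simp add: algebra_simps)
    also have "\<dots> = 2 * (a - b) * Gamma (a - b) * Gamma ((a + 1) / 2) * rGamma a *
        (((a + 1) / 2 - b) * rGamma ((a + 1) / 2 - b + 1))"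
      unfolding IH Gamma_plus1[OF Suc.prems(2)] half by (simp add: mult_ac)
    also have "((a + 1) / 2 - b) * rGamma ((a + 1) / 2 - b + 1) = rGamma ((a + 1) / 2 - b)"
      by (rule rGamma_plus1)
    finally show ?case using nz by (simp add: mult_ac)
  qed
qed

section \<open>Both families of values through one recurrence\<close>

text \<open>Seeds \<open>1, 2 - a\<close> give the numerators for P, seeds \<open>0, a - 1\<close>
  those for Q. The ring is left open because the recurrence is read in \<open>complex\<close>,
  \<open>complex poly\<close>, \<open>complex poly poly\<close> and \<open>ratfun\<close>.\<close>

fun kummer_num :: "'r::comm_ring_1 \<Rightarrow> 'r \<Rightarrow> 'r \<Rightarrow> 'r \<Rightarrow> nat \<Rightarrow> 'r" where
  "kummer_num u v a b 0 = u"
| "kummer_num u v a b (Suc 0) = v"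
| "kummer_num u v a b (Suc (Suc n)) =
     (3 * (of_nat n + 2) - 2 * a) * kummer_num u v a b (Suc n)
     + 2 * (a - of_nat n - 2) * (of_nat n + 1 - b) * kummer_num u v a b n"

definition kummer_factor :: "complex \<Rightarrow> complex \<Rightarrow> complex \<Rightarrow> complex" where
  "kummer_factor s a b = Gamma (a - b) * Gamma s * rGamma a * rGamma (s - b)"

abbreviation "kummer_factor_P a \<equiv> kummer_factor ((a + 1) / 2) a"
abbreviation "kummer_factor_Q a \<equiv> kummer_factor (a / 2) a"

text \<open>Kummer's identity at \<open>a\<close> gives the P factor and, after functional
  equations, at \<open>a + 1\<close> the Q factor; contiguity makes the value for
  \<open>m = 0\<close> their mean.\<close>

lemma hyp2F1_minus_one_0:
  assumes a: "a \<notin> \<int>\<^sub>\<le>\<^sub>0" and ab: "a - b \<notin> \<int>\<^sub>\<le>\<^sub>0"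
  shows "2 * hyp2F1 a b (a - b) (-1) = kummer_factor_P a b + kummer_factor_Q a b"
proof -
  define C where "C = a - b"
  have C: "C \<notin> \<int>\<^sub>\<le>\<^sub>0" "C \<noteq> 0" using ab by (auto simp: C_def)
  have a2: "a / 2 \<notin> \<int>\<^sub>\<le>\<^sub>0" by (rule not_nonpos_Ints_half[OF a])
  have "2 * C * hyp2F1 a b C (-1) = C * hyp2F1 (a - 1) b C (-1) + (C - b) * hyp2F1 a b (C + 1) (-1)"
    using hyp2F1_contiguous_AC[OF C(1), of "a - 1" b] by simp
  also have "hyp2F1 (a - 1) b C (-1) = kummer_factor_P a b"
    using Kummer[OF a ab] by (simp add: C_def kummer_factor_def)
  also have "hyp2F1 a b (C + 1) (-1) = Gamma (C + 1) * Gamma (a / 2 + 1) * rGamma (a + 1) * rGamma (a / 2 - b + 1)"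
  proof -
    have "hyp2F1 (a + 1 - 1) b (a + 1 - b) (-1) = Gamma (a + 1 - b) * Gamma ((a + 1 + 1) / 2) * rGamma (a + 1) * rGamma ((a + 1 + 1) / 2 - b)"
      using not_nonpos_Ints_plus1[OF a] not_nonpos_Ints_plus1[OF ab] by (intro Kummer) (simp_all add: algebra_simps)
    moreover have e: "a + 1 - 1 = a" "a + 1 - b = C + 1" "(a + 1 + 1) / 2 = a / 2 + 1" "a / 2 + 1 - b = a / 2 - b + 1"
      by (simp_all add: C_def add_divide_distrib)
    ultimately show ?thesis by (simp only: e)
  qed
  also have "(C - b) * (Gamma (C + 1) * Gamma (a / 2 + 1) * rGamma (a + 1) * rGamma (a / 2 - b + 1))
      = C * Gamma C * Gamma (a / 2) * (a * rGamma (a + 1)) * ((a / 2 - b) * rGamma (a / 2 - b + 1))"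
  proof -
    have "C - b = 2 * (a / 2 - b)" by (simp add: C_def)
    then show ?thesis
      unfolding Gamma_plus1[OF C(1)] Gamma_plus1[OF a2] by simp
  qed
  also have "\<dots> = C * kummer_factor_Q a b"
    unfolding rGamma_plus1 by (simp add: C_def kummer_factor_def mult_ac)
  finally have "C * (2 * hyp2F1 a b C (-1)) = C * (kummer_factor_P a b + kummer_factor_Q a b)"
    by (simp add: algebra_simps)
  then show ?thesis using C(2) unfolding C_def[symmetric] by simp
qed

theorem hyp2F1_minus_one_down:
  assumes a: "a \<notin> \<int>\<^sub>\<le>\<^sub>0" and ab: "a - b \<notin> \<int>\<^sub>\<le>\<^sub>0"
  shows "pochhammer (1 - b) n * hyp2F1 (a - of_nat n - 1) b (a - b) (-1) =
    kummer_num 1 (2 - a) a b n * kummer_factor_P a b + kummer_num 0 (a - 1) a b n * kummer_factor_Q a b"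
proof -
  define D where "D = (\<lambda>n. hyp2F1 (a - of_nat n - 1) b (a - b) (-1))"
  have D0: "D 0 = kummer_factor_P a b"
    using Kummer[OF a ab] by (simp add: D_def kummer_factor_def)
  have rec: "(of_nat n + 2 - b) * D (Suc (Suc n)) = 2 * (a - of_nat n - 2) * D n - (2 * a - 3 * of_nat n - 6) * D (Suc n)" for n
  proof -
    have A: "a - of_nat n - 3 + 1 = a - of_nat (Suc n) - 1" "a - of_nat n - 3 + 2 = a - of_nat n - 1"
      "a - of_nat n - 3 = a - of_nat (Suc (Suc n)) - 1" by simp_all
    have c: "a - b - (a - of_nat n - 3) - 1 = of_nat n + 2 - b"
      "2 * (a - of_nat n - 3) + 2 - (a - b) - (b - (a - of_nat n - 3) - 1) = 2 * a - 3 * of_nat n - 6"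
      "a - of_nat n - 3 + 1 = a - of_nat n - 2" by simp_all
    have "(of_nat n + 2 - b) * D (Suc (Suc n)) + (2 * a - 3 * of_nat n - 6) * D (Suc n) = 2 * (a - of_nat n - 2) * D n"
      using hyp2F1_contiguous_A[OF ab, of "a - of_nat n - 3" b] unfolding c(1,2)
      unfolding D_def A(1,2)[symmetric] A(3)[symmetric] unfolding c(3) .
    then show ?thesis by (simp add: algebra_simps)
  qed
  \<comment> \<open>Gauss' relation at \<open>A = a - 2\<close> links \<open>m = -2, -1, 0\<close>.
    Since \<open>(a - 1) - (2 a - 3) = 2 - a\<close>, it yields the second seeds of
    \<open>kummer_num\<close>.\<close>
  have D1: "(1 - b) * D 1 = (2 - a) * kummer_factor_P a b + (a - 1) * kummer_factor_Q a b"
  proof -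
    have c: "a - b - (a - 2) - 1 = 1 - b" "2 * (a - 2) + 2 - (a - b) - (b - (a - 2) - 1) = 2 * a - 3"
      "a - 2 + 1 = a - 1" "a - 2 + 2 = a" by simp_all
    have "(1 - b) * D 1 + (2 * a - 3) * D 0 = (a - 1) * (2 * hyp2F1 a b (a - b) (-1))"
      using hyp2F1_contiguous_A[OF ab, of "a - 2" b] unfolding c by (simp add: D_def mult_ac)
    also have "\<dots> = (a - 1) * (kummer_factor_P a b + kummer_factor_Q a b)"
      unfolding hyp2F1_minus_one_0[OF a ab] ..
    finally show ?thesis unfolding D0 by (simp add: algebra_simps)
  qed
  have "pochhammer (1 - b) n * D n =
    kummer_num 1 (2 - a) a b n * kummer_factor_P a b + kummer_num 0 (a - 1) a b n * kummer_factor_Q a b"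
  proof (induction n rule: induct_nat_012)
    case 0
    then show ?case by (simp add: D0)
  next
    case 1
    then show ?case using D1 by simp
  next
    case (ge2 n)
    have p: "pochhammer (1 - b) (Suc (Suc n)) = pochhammer (1 - b) (Suc n) * (of_nat n + 2 - b)"
      "pochhammer (1 - b) (Suc n) = pochhammer (1 - b) n * (of_nat n + 1 - b)"
      by (simp_all add: pochhammer_Suc algebra_simps)
    have "pochhammer (1 - b) (Suc (Suc n)) * D (Suc (Suc n)) = pochhammer (1 - b) (Suc n) * ((of_nat n + 2 - b) * D (Suc (Suc n)))"
      unfolding p(1) by (simp only: mult_ac)
    also have "\<dots> = (3 * (of_nat n + 2) - 2 * a) * (pochhammer (1 - b) (Suc n) * D (Suc n))
        + 2 * (a - of_nat n - 2) * (pochhammer (1 - b) (Suc n) * D n)"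
      unfolding rec by (simp add: algebra_simps)
    also have "pochhammer (1 - b) (Suc n) * D n = (of_nat n + 1 - b) * (pochhammer (1 - b) n * D n)"
      unfolding p(2) by (simp only: mult_ac)
    finally show ?case
      unfolding ge2 by (simp add: algebra_simps)
  qed
  then show ?thesis by (simp add: D_def)
qed

text \<open>The factor \<open>(-1)^n\<close> flips the middle coefficient of the recurrence from the
  differential equation, which then is that of \<open>kummer_num\<close>. The minus sign before the
  second term is forced by the value at \<open>n = 1\<close> and causes the sign in the identity for
  Q.\<close>

lemma hyp2F1_minus_one_diagonal:
  assumes a: "a - 2 * of_nat n \<notin> \<int>\<^sub>\<le>\<^sub>0" and ab: "a - b - of_nat n \<notin> \<int>\<^sub>\<le>\<^sub>0"
  shows "(-1) ^ n * (hyp2F1 (a - of_nat n - 1) (b - of_nat n) (a - b - of_nat n) (-1) * rGamma (a - b - of_nat n)) =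
    kummer_num 1 (2 - a) a b n * (Gamma ((a + 1) / 2) * rGamma a * rGamma ((a + 1) / 2 - b))
    - kummer_num 0 (a - 1) a b n * (Gamma (a / 2) * rGamma a * rGamma (a / 2 - b))"
  using assms
proof (induction n rule: induct_nat_012)
  case 0
  then have "Gamma (a - b) * rGamma (a - b) = 1"
    by (simp add: rGamma_inverse_Gamma Gamma_eq_zero_iff)
  then show ?case
    using Kummer[of a b] 0 by simp
next
  case 1
  \<comment> \<open>The value for \<open>m = 0\<close> at \<open>(a - 2, b - 1)\<close>. Moving its
    Gamma factors back to \<open>a\<close> produces \<open>s = a - 2\<close> in the first term and
    \<open>s + 1 = a - 1\<close> in the second.\<close>
  define s where "s = a - 2"
  have nz: "s \<notin> \<int>\<^sub>\<le>\<^sub>0" "s - (b - 1) \<notin> \<int>\<^sub>\<le>\<^sub>0" using 1 by (simp_all add: s_def algebra_simps)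
  have "2 * hyp2F1 s (b - 1) (s - (b - 1)) (-1) * rGamma (s - (b - 1))
     = Gamma ((s + 1) / 2) * rGamma s * rGamma ((s + 1) / 2 - (b - 1))
      + Gamma (s / 2) * rGamma s * rGamma (s / 2 - (b - 1))"
  proof -
    have inv: "Gamma (s - (b - 1)) * rGamma (s - (b - 1)) = 1"
      using nz(2) by (simp add: rGamma_inverse_Gamma Gamma_eq_zero_iff)
    have "2 * hyp2F1 s (b - 1) (s - (b - 1)) (-1) * rGamma (s - (b - 1))
       = (Gamma (s - (b - 1)) * rGamma (s - (b - 1))) * (Gamma ((s + 1) / 2) * rGamma s * rGamma ((s + 1) / 2 - (b - 1))
        + Gamma (s / 2) * rGamma s * rGamma (s / 2 - (b - 1)))"
      unfolding hyp2F1_minus_one_0[OF nz] kummer_factor_def by (simp only: ring_distribs mult_ac)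
    then show ?thesis unfolding inv by simp
  qed
  also have "(s + 1) / 2 - (b - 1) = (a + 1) / 2 - b" by (simp add: s_def field_simps)
  also have "s / 2 - (b - 1) = a / 2 - b" by (simp add: s_def field_simps)
  also have "rGamma s = s * (s + 1) * rGamma a"
  proof -
    have "rGamma s = s * ((s + 1) * rGamma (s + 1 + 1))" by (simp only: rGamma_plus1)
    then show ?thesis by (simp add: s_def)
  qed
  also have "Gamma ((s + 1) / 2) * (s * (s + 1) * rGamma a) * rGamma ((a + 1) / 2 - b)
     = 2 * s * (((s + 1) / 2 * Gamma ((s + 1) / 2)) * rGamma a * rGamma ((a + 1) / 2 - b))"
    by simp
  also have "(s + 1) / 2 * Gamma ((s + 1) / 2) = Gamma ((a + 1) / 2)"
  proof -
    have "(s + 1) / 2 + 1 = (a + 1) / 2" by (simp add: s_def field_simps)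
    then show ?thesis
      using Gamma_plus1[OF not_nonpos_Ints_half(2)[OF nz(1)]] by metis
  qed
  also have "Gamma (s / 2) * (s * (s + 1) * rGamma a) * rGamma (a / 2 - b)
     = 2 * (s + 1) * ((s / 2 * Gamma (s / 2)) * rGamma a * rGamma (a / 2 - b))"
    by simp
  also have "s / 2 * Gamma (s / 2) = Gamma (a / 2)"
  proof -
    have "s / 2 + 1 = a / 2" by (simp add: s_def field_simps)
    then show ?thesis
      using Gamma_plus1[OF not_nonpos_Ints_half(1)[OF nz(1)]] by metis
  qed
  finally have "2 * (hyp2F1 s (b - 1) (s - (b - 1)) (-1) * rGamma (s - (b - 1))) =
      2 * (s * (Gamma ((a + 1) / 2) * rGamma a * rGamma ((a + 1) / 2 - b))
      + (s + 1) * (Gamma (a / 2) * rGamma a * rGamma (a / 2 - b)))"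
    by (simp only: ring_distribs mult.assoc)
  then have "hyp2F1 s (b - 1) (s - (b - 1)) (-1) * rGamma (s - (b - 1)) =
      s * (Gamma ((a + 1) / 2) * rGamma a * rGamma ((a + 1) / 2 - b))
      + (s + 1) * (Gamma (a / 2) * rGamma a * rGamma (a / 2 - b))"
    by (simp only: mult_cancel_left) simp
  moreover have "s - (b - 1) = a - b - 1" by (simp add: s_def)
  ultimately show ?case by (simp add: s_def algebra_simps)
next
  case (ge2 n)
  define A B C where "A = a - of_nat n - 3" and "B = b - of_nat n - 2" and "C = a - b - of_nat n - 2"
  have C: "C \<notin> \<int>\<^sub>\<le>\<^sub>0" using ge2.prems(2) by (simp add: C_def algebra_simps)
  have prems: "a - 2 * of_nat n \<notin> \<int>\<^sub>\<le>\<^sub>0" "a - 2 * of_nat (Suc n) \<notin> \<int>\<^sub>\<le>\<^sub>0"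
    "a - b - of_nat n \<notin> \<int>\<^sub>\<le>\<^sub>0" "a - b - of_nat (Suc n) \<notin> \<int>\<^sub>\<le>\<^sub>0"
    using not_nonpos_Ints_plus_of_nat[OF ge2.prems(1), of 4] not_nonpos_Ints_plus_of_nat[OF ge2.prems(1), of 2]
      not_nonpos_Ints_plus_of_nat[OF ge2.prems(2), of 2] not_nonpos_Ints_plus_of_nat[OF ge2.prems(2), of 1]
    by (simp_all add: algebra_simps)
  define F where "F = (\<lambda>k. hyp2F1 (a - of_nat k - 1) (b - of_nat k) (a - b - of_nat k) (-1) * rGamma (a - b - of_nat k))"
  have F: "F (Suc (Suc n)) = hyp2F1 A B C (-1) * rGamma C"
    "F (Suc n) = hyp2F1 (A + 1) (B + 1) (C + 1) (-1) * rGamma (C + 1)"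
    "F n = hyp2F1 (A + 2) (B + 2) (C + 2) (-1) * rGamma (C + 2)"
    by (simp_all add: F_def A_def B_def C_def algebra_simps)
  have rG: "rGamma (C + 1) = (C + 1) * rGamma (C + 2)" "rGamma C = C * (C + 1) * rGamma (C + 2)"
    using rGamma_plus1[of C, symmetric] rGamma_plus1[of "C + 1", symmetric] by (simp_all add: add.assoc mult.assoc)
  have "F (Suc (Suc n)) = (C * (C + 1) * hyp2F1 A B C (-1)) * rGamma (C + 2)"
    unfolding F rG by (simp only: mult_ac)
  also have "\<dots> = (C + A + B + 1) * F (Suc n) - 2 * (A + 1) * (B + 1) * F n"
    unfolding hyp2F1_contiguous_ABC[OF C] F rG by (simp add: algebra_simps)
  also have "C + A + B + 1 = 2 * a - 3 * of_nat n - 6" by (simp add: A_def B_def C_def)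
  also have "2 * (A + 1) * (B + 1) = 2 * (a - of_nat n - 2) * (b - of_nat n - 1)" by (simp add: A_def B_def)
  finally have R: "F (Suc (Suc n)) = (2 * a - 3 * of_nat n - 6) * F (Suc n) - 2 * (a - of_nat n - 2) * (b - of_nat n - 1) * F n" .
  have "(-1) ^ Suc (Suc n) * F (Suc (Suc n)) = (3 * (of_nat n + 2) - 2 * a) * ((-1) ^ Suc n * F (Suc n))
     + 2 * (a - of_nat n - 2) * (of_nat n + 1 - b) * ((-1) ^ n * F n)"
    unfolding R by (simp add: algebra_simps)
  also have "(-1) ^ Suc n * F (Suc n) = kummer_num 1 (2 - a) a b (Suc n) * (Gamma ((a + 1) / 2) * rGamma a * rGamma ((a + 1) / 2 - b))
    - kummer_num 0 (a - 1) a b (Suc n) * (Gamma (a / 2) * rGamma a * rGamma (a / 2 - b))"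
    unfolding F_def by (rule ge2.IH(2)[OF prems(2,4)])
  also have "(-1) ^ n * F n = kummer_num 1 (2 - a) a b n * (Gamma ((a + 1) / 2) * rGamma a * rGamma ((a + 1) / 2 - b))
    - kummer_num 0 (a - 1) a b n * (Gamma (a / 2) * rGamma a * rGamma (a / 2 - b))"
    unfolding F_def by (rule ge2.IH(1)[OF prems(1,3)])
  finally show ?case
    unfolding F_def by (simp add: algebra_simps)
qed

text \<open>The diagonal formula read at \<open>(a + 2 n, b + n)\<close>. Shifting
  \<open>rGamma a'\<close> costs \<open>4^n p q\<close>; the Gamma values at half arguments give
  back \<open>q\<close> in the first term and \<open>p\<close> in the second, so one of the two
  stays in each denominator.\<close>

theorem hyp2F1_minus_one_up:
  fixes n :: nat
  assumes a: "a \<notin> \<int>\<^sub>\<le>\<^sub>0" and ab: "a - b \<notin> \<int>\<^sub>\<le>\<^sub>0"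
  defines "a' \<equiv> a + 2 * of_nat n" and "b' \<equiv> b + of_nat n"
  shows "hyp2F1 (a + of_nat n - 1) b (a - b) (-1) =
    kummer_num 1 (2 - a') a' b' n / ((-4) ^ n * pochhammer (a / 2) n) * kummer_factor_P a b
    + kummer_num 0 (a' - 1) a' b' n / (- ((-4) ^ n * pochhammer ((a + 1) / 2) n)) * kummer_factor_Q a b"
proof -
  define N M where "N = kummer_num 1 (2 - a') a' b' n" and "M = kummer_num 0 (a' - 1) a' b' n"
  define H where "H = hyp2F1 (a + of_nat n - 1) b (a - b) (-1)"
  define p q where "p = pochhammer (a / 2) n" and "q = pochhammer ((a + 1) / 2) n"
  have pq: "p \<noteq> 0" "q \<noteq> 0"
    using not_nonpos_Ints_half[OF a] by (auto simp: p_def q_def pochhammer_neq_0)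
  have "(-1) ^ n * (H * rGamma (a - b)) = N * (Gamma ((a' + 1) / 2) * rGamma a' * rGamma ((a' + 1) / 2 - b'))
    - M * (Gamma (a' / 2) * rGamma a' * rGamma (a' / 2 - b'))"
  proof -
    have e: "a' - of_nat n - 1 = a + of_nat n - 1" "b' - of_nat n = b" "a' - b' - of_nat n = a - b"
      "a' - 2 * of_nat n = a"
      by (simp_all add: a'_def b'_def)
    show ?thesis
      using hyp2F1_minus_one_diagonal[of a' n b'] a ab unfolding e N_def M_def H_def by simp
  qed
  moreover have "Gamma ((a' + 1) / 2) = q * Gamma ((a + 1) / 2)"
    using pochhammer_Gamma[OF not_nonpos_Ints_half(2)[OF a], of n] not_nonpos_Ints_half(2)[OF a]
    by (simp add: q_def a'_def add_divide_distrib add_ac Gamma_eq_zero_iff)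
  moreover have "Gamma (a' / 2) = p * Gamma (a / 2)"
    using pochhammer_Gamma[OF not_nonpos_Ints_half(1)[OF a], of n] not_nonpos_Ints_half(1)[OF a]
    by (simp add: p_def a'_def add_divide_distrib add_ac Gamma_eq_zero_iff)
  moreover have "rGamma a = 4 ^ n * p * q * rGamma a'"
  proof -
    have "pochhammer a (2 * n) = 4 ^ n * p * q"
      using pochhammer_double[of "a / 2" n] by (simp add: p_def q_def add_divide_distrib power_mult)
    then show ?thesis
      using pochhammer_rGamma[of a "2 * n"] by (simp add: a'_def)
  qed
  then have "rGamma a' = rGamma a / (4 ^ n * p * q)" using pq by simp
  moreover have "(a' + 1) / 2 - b' = (a + 1) / 2 - b" "a' / 2 - b' = a / 2 - b"
    by (simp_all add: a'_def b'_def add_divide_distrib)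
  ultimately have E: "(-1) ^ n * (H * rGamma (a - b)) = N * (q * Gamma ((a + 1) / 2) * (rGamma a / (4 ^ n * p * q)) * rGamma ((a + 1) / 2 - b))
    - M * (p * Gamma (a / 2) * (rGamma a / (4 ^ n * p * q)) * rGamma (a / 2 - b))"
    by simp
  have "rGamma (a - b) * Gamma (a - b) = 1"
    using ab by (simp add: rGamma_inverse_Gamma Gamma_eq_zero_iff)
  then have "H = (-1) ^ n * ((-1) ^ n * (H * rGamma (a - b))) * Gamma (a - b)"
    by (simp flip: power_mult_distrib add: mult.assoc[symmetric])
  also have "\<dots> = (-1) ^ n * N / (4 ^ n * p) * kummer_factor_P a b - (-1) ^ n * M / (4 ^ n * q) * kummer_factor_Q a b"
    unfolding E kummer_factor_def using pq by (simp add: ring_distribs diff_divide_distrib mult_ac)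
  also have "(-1) ^ n * N / (4 ^ n * p) = N / ((-4) ^ n * p)"
    by (simp add: power_minus[of 4] divide_simps)
  also have "(-1) ^ n * M / (4 ^ n * q) = M / ((-4) ^ n * q)"
    by (simp add: power_minus[of 4] divide_simps)
  finally show ?thesis
    unfolding H_def N_def M_def p_def q_def by simp
qed

section \<open>Evaluation of rational functions and uniqueness\<close>

text \<open>Evaluation at a point, \<open>to_fract\<close>, constant embeddings and partial
  specialization are all instances, so one lemma transports \<open>kummer_num\<close> between its
  rings.\<close>

definition ring_homo :: "('r::comm_ring_1 \<Rightarrow> 's::comm_ring_1) \<Rightarrow> bool" where
  "ring_homo f \<longleftrightarrow> f 0 = 0 \<and> f 1 = 1 \<and> (\<forall>x y. f (x + y) = f x + f y) \<and> (\<forall>x y. f (x * y) = f x * f y)"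

lemma ring_homo_0: "ring_homo f \<Longrightarrow> f 0 = 0"
  and ring_homo_1: "ring_homo f \<Longrightarrow> f 1 = 1"
  and ring_homo_add: "ring_homo f \<Longrightarrow> f (x + y) = f x + f y"
  and ring_homo_mult: "ring_homo f \<Longrightarrow> f (x * y) = f x * f y"
  by (auto simp: ring_homo_def)

lemma ring_homo_uminus: "ring_homo f \<Longrightarrow> f (- x) = - f x"
  using ring_homo_add[of f x "- x"] by (simp add: ring_homo_0 eq_neg_iff_add_eq_0 add.commute)

lemma ring_homo_diff: "ring_homo f \<Longrightarrow> f (x - y) = f x - f y"
  using ring_homo_add[of f x "-y"] ring_homo_uminus[of f y] by simp

lemma ring_homo_of_nat: "ring_homo f \<Longrightarrow> f (of_nat n) = of_nat n"
  by (induction n) (auto simp: ring_homo_0 ring_homo_1 ring_homo_add)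

lemma ring_homo_numeral: "ring_homo f \<Longrightarrow> f (numeral n) = numeral n"
  using ring_homo_of_nat[of f "numeral n"] by simp

lemma ring_homo_power: "ring_homo f \<Longrightarrow> f (x ^ n) = f x ^ n"
  by (induction n) (auto simp: ring_homo_1 ring_homo_mult)

lemma ring_homo_pochhammer: "ring_homo f \<Longrightarrow> f (pochhammer x n) = pochhammer (f x) n"
  by (induction n) (auto simp: ring_homo_1 pochhammer_Suc ring_homo_mult ring_homo_add ring_homo_of_nat)

lemmas ring_homo_simps = ring_homo_add ring_homo_mult ring_homo_uminus ring_homo_diff ring_homo_of_nat
  ring_homo_numeral ring_homo_power ring_homo_pochhammer

lemma ring_homo_poly_map_poly:
  assumes f: "ring_homo f"
  shows "ring_homo (\<lambda>p. poly (map_poly f p) y)"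
proof -
  note f0 = ring_homo_0[OF f]
  have add: "poly (map_poly f (p + q)) y = poly (map_poly f p) y + poly (map_poly f q) y" for p q
  proof (induction p q rule: poly_induct2)
    case (pCons a p b q)
    then show ?case by (simp add: map_poly_pCons f0 ring_homo_add[OF f] distrib_left add_ac)
  qed simp
  have smult: "poly (map_poly f (smult c p)) y = f c * poly (map_poly f p) y" for c p
  proof (induction p)
    case (pCons a p)
    then show ?case by (simp add: map_poly_pCons f0 ring_homo_mult[OF f] distrib_left mult_ac)
  qed simp
  have mult: "poly (map_poly f (p * q)) y = poly (map_poly f p) y * poly (map_poly f q) y" for p q
  proof (induction p)
    case (pCons a p)
    then show ?case by (simp add: map_poly_pCons f0 add smult ring_distribs mult_ac)
  qed simp
  show ?thesis
    unfolding ring_homo_def using add mult by (simp add: ring_homo_1[OF f])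
qed

lemma ring_homo_poly2_at:
  assumes "ring_homo h"
  shows "ring_homo (\<lambda>p. poly2_at h p x y)"
  unfolding poly2_at_def by (intro ring_homo_poly_map_poly assms)

lemma ring_homo_id: "ring_homo id"
  by (simp add: ring_homo_def)

lemma ring_homo_ratfun_const: "ring_homo ratfun_const"
proof -
  have "ratfun_const (x + y) = ratfun_const x + ratfun_const y"
    "ratfun_const (x * y) = ratfun_const x * ratfun_const y" for x y
    unfolding ratfun_const_def to_fract_add[symmetric] to_fract_mult[symmetric] by simp_all
  moreover have "ratfun_const 1 = 1" "ratfun_const 0 = 0"
    unfolding ratfun_const_def by (simp_all add: pCons_one)
  ultimately show ?thesis by (simp add: ring_homo_def)
qed

lemma ring_homo_to_fract: "ring_homo to_fract"
  by (simp add: ring_homo_def)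

abbreviation poly_a :: "complex poly poly" where "poly_a \<equiv> [:[:0, 1:]:]"
abbreviation poly_b :: "complex poly poly" where "poly_b \<equiv> [:0, 1:]"
abbreviation poly_const :: "complex \<Rightarrow> complex poly poly" where "poly_const c \<equiv> [:[:c:]:]"

lemma poly2_at_generators:
  assumes "ring_homo h"
  shows "poly2_at h poly_a x y = x" "poly2_at h poly_b x y = y" "poly2_at h (poly_const c) x y = h c"
  using ring_homo_0[OF assms] ring_homo_1[OF assms]
  by (simp_all add: poly2_at_def map_poly_pCons)

text \<open>A given representation differs from lowest terms by a common factor \<open>d\<close>,
  which is the handle on cancellation below.\<close>

lemma quot_of_fract_Fract:
  fixes N D :: "complex poly poly"
  assumes "D \<noteq> 0"
  obtains d where "N = fst (quot_of_fract (Fract N D)) * d" "D = snd (quot_of_fract (Fract N D)) * d"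
proof -
  have "quot_of_fract (Fract N D) = normalize_quot (N, D)"
    using quot_of_fract_quot_to_fract[of "(N, D)"] by (simp add: quot_to_fract_def)
  then show ?thesis
    using normalize_quotE[OF assms, of N] that by metis
qed

text \<open>The cancelled factor divides the given denominator, so it is nonzero at the point too.
  The converse of the first claim fails in general: lowest terms may be regular where the given
  denominator vanishes.\<close>

lemma ratfun_at_Fract:
  assumes h: "ring_homo h" and D: "poly2_at h D x y \<noteq> 0"
  shows "poly2_at h (snd (quot_of_fract (Fract N D))) x y \<noteq> 0"
    and "ratfun_at h (Fract N D) x y = poly2_at h N x y / poly2_at h D x y"
proof -
  note ev = ring_homo_poly2_at[OF h, of x y]
  have "D \<noteq> 0" using D ring_homo_0[OF ev] by auto
  then obtain d where d: "N = fst (quot_of_fract (Fract N D)) * d" "D = snd (quot_of_fract (Fract N D)) * d"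
    by (rule quot_of_fract_Fract)
  have N: "poly2_at h N x y = poly2_at h (fst (quot_of_fract (Fract N D))) x y * poly2_at h d x y"
    using ring_homo_mult[OF ev] d(1) by metis
  have D': "poly2_at h D x y = poly2_at h (snd (quot_of_fract (Fract N D))) x y * poly2_at h d x y"
    using ring_homo_mult[OF ev] d(2) by metis
  show "poly2_at h (snd (quot_of_fract (Fract N D))) x y \<noteq> 0" using D D' by auto
  show "ratfun_at h (Fract N D) x y = poly2_at h N x y / poly2_at h D x y"
    unfolding ratfun_at_def N D' using D D' by auto
qed

section \<open>Zeros of bivariate polynomials and uniqueness of the coefficients\<close>

lemma poly2_zero_section:
  assumes "p \<noteq> 0"
  shows "finite {a. \<forall>b. poly2_at id p a b = 0}"
proof -
  have "{a. \<forall>b. poly2_at id p a b = 0} \<subseteq> {a. poly (lead_coeff p) a = 0}"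
  proof safe
    fix a assume "\<forall>b. poly2_at id p a b = 0"
    then have "map_poly (\<lambda>c. poly c a) p = 0"
      by (simp add: poly2_at_def poly_all_0_iff_0)
    then have "coeff (map_poly (\<lambda>c. poly c a) p) (degree p) = 0" by simp
    then show "poly (lead_coeff p) a = 0" by (simp add: coeff_map_poly)
  qed
  moreover have "finite {a. poly (lead_coeff p) a = 0}"
    using assms by (intro poly_roots_finite) simp
  ultimately show ?thesis by (rule finite_subset)
qed

text \<open>For all but finitely many \<open>a\<close>, a nonzero polynomial specializes to a
  nonzero polynomial in \<open>b\<close>, which has finitely many roots.\<close>

lemma poly2_eq_0:
  assumes "infinite S" and "\<And>a. a \<in> S \<Longrightarrow> infinite {b. poly2_at id p a b = 0}"
  shows "p = 0"
proof (rule ccontr)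
  assume "p \<noteq> 0"
  from poly2_zero_section[OF this] assms(1) have "\<not> S \<subseteq> {a. \<forall>b. poly2_at id p a b = 0}"
    using finite_subset by blast
  then obtain a where a: "a \<in> S" "\<not> (\<forall>b. poly2_at id p a b = 0)" by blast
  then have "map_poly (\<lambda>c. poly c a) p \<noteq> 0" by (auto simp: poly2_at_def)
  from poly_roots_finite[OF this] show False
    using assms(2)[OF a(1)] by (simp add: poly2_at_def)
qed

lemma Ints_infinite_complement: "infinite (- \<int> :: complex set)"
proof
  assume "finite (- \<int> :: complex set)"
  moreover have "countable (\<int> :: complex set)" by (rule countable_int)
  ultimately have "countable (UNIV :: complex set)"
    using countable_Un_iff[of "\<int>" "- \<int> :: complex set"] by (simp add: uncountable_infinite countable_finite Compl_partition)
  then show False using uncountable_UNIV_complex by blast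
qed

lemma half_notin_nonpos_Ints:
  "1 / 2 - of_nat k \<notin> (\<int>\<^sub>\<le>\<^sub>0 :: complex set)" "- 1 / 2 - of_nat k \<notin> (\<int>\<^sub>\<le>\<^sub>0 :: complex set)"
proof -
  have "(1 / 2 :: complex) \<noteq> of_int j" for j
  proof
    assume "(1 / 2 :: complex) = of_int j"
    then have "of_int 1 = (of_int (2 * j) :: complex)" by (simp add: field_simps)
    then have "1 = 2 * j" by (simp only: of_int_eq_iff)
    then show False by presburger
  qed
  note * = this
  show "1 / 2 - of_nat k \<notin> (\<int>\<^sub>\<le>\<^sub>0 :: complex set)"
  proof
    assume "1 / 2 - of_nat k \<in> (\<int>\<^sub>\<le>\<^sub>0 :: complex set)"
    then obtain j where "1 / 2 - of_nat k = - (of_nat j :: complex)" by (elim nonpos_Ints_cases')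
    then have "(1 / 2 :: complex) = of_int (int k - int j)" by (simp add: diff_eq_eq)
    then show False using * by blast
  qed
  show "- 1 / 2 - of_nat k \<notin> (\<int>\<^sub>\<le>\<^sub>0 :: complex set)"
  proof
    assume "- 1 / 2 - of_nat k \<in> (\<int>\<^sub>\<le>\<^sub>0 :: complex set)"
    then obtain j where "- 1 / 2 - of_nat k = - (of_nat j :: complex)" by (elim nonpos_Ints_cases')
    then have "of_nat j - of_nat k = (1 / 2 :: complex)" by (simp add: diff_eq_eq algebra_simps)
    then have "(1 / 2 :: complex) = of_int (int j - int k)" by simp
    then show False using * by blast
  qed
qed


lemma diff_add_eq_diff:
  fixes x y z k :: complex
  assumes "x = y + z"
  shows "x - (y + k) = z - k"
  unfolding assms by (simp only: add_diff_cancel_left)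

text \<open>
  At \<open>b = a/2 + k\<close> the second Gamma factor vanishes and the first does not, and vice versa at
  \<open>b = (a+1)/2 + k\<close>; so each coefficient is determined at infinitely many \<open>b\<close> for every non-integral \<open>a\<close>.
\<close>

lemma kummer_decomposition_unique:
  assumes 1: "kummer_decomposition m p q" and 2: "kummer_decomposition m p' q'"
  shows "p = p'" "q = q'"
proof -
  obtain pn pd where p: "quot_of_fract p = (pn, pd)" by fastforce
  obtain qn qd where q: "quot_of_fract q = (qn, qd)" by fastforce
  obtain pn' pd' where p': "quot_of_fract p' = (pn', pd')" by fastforce
  obtain qn' qd' where q': "quot_of_fract q' = (qn', qd')" by fastforce
  note ev = ring_homo_poly2_at[OF ring_homo_id]
  \<comment> \<open>Where \<open>D\<close> is nonzero all four reduced fractions are regular, so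
    both decompositions apply.\<close>
  define D where "D = pd * qd * pd' * qd'"
  have nz: "pd \<noteq> 0" "qd \<noteq> 0" "pd' \<noteq> 0" "qd' \<noteq> 0"
    using snd_quot_of_fract_nonzero[of p] snd_quot_of_fract_nonzero[of q]
      snd_quot_of_fract_nonzero[of p'] snd_quot_of_fract_nonzero[of q'] by (simp_all add: p q p' q')
  then have "D \<noteq> 0" by (simp add: D_def)
  define S where "S = (- \<int> :: complex set)"
  have S: "infinite S" unfolding S_def by (rule Ints_infinite_complement)
  have eq: "ratfun_eval p a b * (Gamma ((a + 1) / 2) * rGamma ((a + 1) / 2 - b)) + ratfun_eval q a b * (Gamma (a / 2) * rGamma (a / 2 - b)) =
     ratfun_eval p' a b * (Gamma ((a + 1) / 2) * rGamma ((a + 1) / 2 - b)) + ratfun_eval q' a b * (Gamma (a / 2) * rGamma (a / 2 - b))"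
    if "a \<in> S" "a - b \<notin> \<int>" "poly2_at id D a b \<noteq> 0" for a b
  proof -
    have a: "a \<notin> \<int>\<^sub>\<le>\<^sub>0" "a - b \<notin> \<int>\<^sub>\<le>\<^sub>0" using that by (auto simp: S_def)
    have reg: "ratfun_regular p a b" "ratfun_regular q a b" "ratfun_regular p' a b" "ratfun_regular q' a b"
      using that(3) by (auto simp: ratfun_regular_def p q p' q' D_def ring_homo_mult[OF ev])
    define c where "c = Gamma (a - b) * rGamma a"
    have c: "c \<noteq> 0" using a by (simp add: c_def Gamma_eq_zero_iff rGamma_eq_zero_iff)
    have "c * (ratfun_eval p a b * (Gamma ((a + 1) / 2) * rGamma ((a + 1) / 2 - b)) + ratfun_eval q a b * (Gamma (a / 2) * rGamma (a / 2 - b)))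
      = hyp2F1 (a + of_int m) b (a - b) (-1)"
      unfolding 1[unfolded kummer_decomposition_def, rule_format, OF a reg(1,2)] c_def
      by (simp only: divide_inverse inverse_mult_distrib rGamma_inverse_Gamma ring_distribs mult_ac)
    also have "\<dots> = c * (ratfun_eval p' a b * (Gamma ((a + 1) / 2) * rGamma ((a + 1) / 2 - b)) + ratfun_eval q' a b * (Gamma (a / 2) * rGamma (a / 2 - b)))"
      unfolding 2[unfolded kummer_decomposition_def, rule_format, OF a reg(3,4)] c_def
      by (simp only: divide_inverse inverse_mult_distrib rGamma_inverse_Gamma ring_distribs mult_ac)
    finally show ?thesis using c by simp
  qed
  have half: "a / 2 + of_nat k \<notin> \<int>" "a / 2 - of_nat k \<notin> \<int>" "(a + 1) / 2 + of_nat k \<notin> \<int>" "(a + 1) / 2 - of_nat k \<notin> \<int>"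
    "(a - 1) / 2 - of_nat k \<notin> \<int>"
    if "a \<in> S" for a k
  proof -
    have a: "a \<in> \<int>" if "2 * x + of_int j = a" "x \<in> \<int>" for x j
      unfolding that(1)[symmetric] using that(2) by simp
    have "a \<notin> \<int>" using that by (simp add: S_def)
    then have *: "x \<notin> \<int>" if "2 * x + of_int j = a" for x j
      using a that by blast
    show "a / 2 + of_nat k \<notin> \<int>" by (rule *[of _ "- 2 * int k"]) simp
    show "a / 2 - of_nat k \<notin> \<int>" by (rule *[of _ "2 * int k"]) simp
    show "(a + 1) / 2 + of_nat k \<notin> \<int>" by (rule *[of _ "- 2 * int k - 1"]) simp
    show "(a + 1) / 2 - of_nat k \<notin> \<int>" by (rule *[of _ "2 * int k - 1"]) simp
    show "(a - 1) / 2 - of_nat k \<notin> \<int>" by (rule *[of _ "2 * int k + 1"]) simp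
  qed
  \<comment> \<open>Multiplying by \<open>D\<close> absorbs the exceptional points:
    \<open>N D\<close> vanishes at every \<open>(a, c a + k)\<close>, hence at infinitely many
    second arguments for each \<open>a\<close> in \<open>S\<close>.\<close>
  have crit: "N = 0" if N: "\<And>a k. a \<in> S \<Longrightarrow> poly2_at id D a (c a + of_nat k) \<noteq> 0 \<Longrightarrow> poly2_at id N a (c a + of_nat k) = 0" for N c
  proof -
    have "N * D = 0"
    proof (rule poly2_eq_0[OF S])
      fix a assume a: "a \<in> S"
      have "poly2_at id (N * D) a (c a + of_nat k) = 0" for k
        using N[OF a, of k] by (auto simp: ring_homo_mult[OF ev])
      then have "range (\<lambda>k::nat. c a + of_nat k) \<subseteq> {b. poly2_at id (N * D) a b = 0}" by auto
      moreover have "infinite (range (\<lambda>k::nat. c a + of_nat k))"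
        by (intro range_inj_infinite) (auto simp: inj_def)
      ultimately show "infinite {b. poly2_at id (N * D) a b = 0}" using finite_subset by blast
    qed
    then show ?thesis using \<open>D \<noteq> 0\<close> by simp
  qed
  have "pn * pd' - pn' * pd = 0"
  proof (rule crit[where c = "\<lambda>a. a / 2"])
    fix a k assume a: "a \<in> S" and D: "poly2_at id D a (a / 2 + of_nat k) \<noteq> 0"
    define b where "b = a / 2 + of_nat k"
    have "a - b = a / 2 - of_nat k"
      unfolding b_def by (rule diff_add_eq_diff) (simp flip: add_divide_distrib mult_2)
    then have ab: "a - b \<notin> \<int>" using half(2)[OF a, of k] by simp
    have "a / 2 - b = - of_nat k" by (simp add: b_def)
    then have zero: "rGamma (a / 2 - b) = 0" by (simp add: rGamma_eq_zero_iff)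
    have "ratfun_eval p a b * (Gamma ((a + 1) / 2) * rGamma ((a + 1) / 2 - b)) = ratfun_eval p' a b * (Gamma ((a + 1) / 2) * rGamma ((a + 1) / 2 - b))"
      using eq[OF a ab D[folded b_def]] unfolding zero by (simp only: mult_zero_right add_0_right add_0_left)
    moreover have "Gamma ((a + 1) / 2) \<noteq> 0"
      using half(3)[OF a, of 0] by (metis Gamma_eq_zero_iff nonpos_Ints_Int of_nat_0 add.right_neutral diff_zero)
    moreover have "(a + 1) / 2 - b = 1 / 2 - of_nat k" by (simp add: b_def add_divide_distrib)
    then have "rGamma ((a + 1) / 2 - b) \<noteq> 0"
      using half_notin_nonpos_Ints[of k] by (simp add: rGamma_eq_zero_iff)
    ultimately have ev_eq: "ratfun_eval p a b = ratfun_eval p' a b" by simp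
    have "poly2_at id pd a b \<noteq> 0" "poly2_at id pd' a b \<noteq> 0"
      using D unfolding b_def[symmetric] D_def ring_homo_mult[OF ev] by auto
    then have "poly2_at id pn a b * poly2_at id pd' a b = poly2_at id pn' a b * poly2_at id pd a b"
      using ev_eq by (simp add: ratfun_eval_def ratfun_at_def p p' frac_eq_eq)
    then show "poly2_at id (pn * pd' - pn' * pd) a (a / 2 + of_nat k) = 0"
      unfolding b_def[symmetric] ring_homo_diff[OF ev] ring_homo_mult[OF ev] by simp
  qed
  then have "Fract pn pd = Fract pn' pd'" using nz by (simp add: eq_fract)
  then show "p = p'" using Fract_quot_of_fract[of p] Fract_quot_of_fract[of p'] by (simp add: p p')
  have "qn * qd' - qn' * qd = 0"
  proof (rule crit[where c = "\<lambda>a. (a + 1) / 2"])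
    fix a k assume a: "a \<in> S" and D: "poly2_at id D a ((a + 1) / 2 + of_nat k) \<noteq> 0"
    define b where "b = (a + 1) / 2 + of_nat k"
    have "a - b = (a - 1) / 2 - of_nat k"
      unfolding b_def
    proof (rule diff_add_eq_diff)
      have "(a + 1) / 2 + (a - 1) / 2 = (a + 1 + (a - 1)) / 2" by (rule add_divide_distrib[symmetric])
      also have "a + 1 + (a - 1) = 2 * a" by simp
      finally show "a = (a + 1) / 2 + (a - 1) / 2" by simp
    qed
    then have ab: "a - b \<notin> \<int>" using half(5)[OF a, of k] by simp
    have "(a + 1) / 2 - b = - of_nat k" by (simp add: b_def)
    then have zero: "rGamma ((a + 1) / 2 - b) = 0" by (simp add: rGamma_eq_zero_iff)
    have "ratfun_eval q a b * (Gamma (a / 2) * rGamma (a / 2 - b)) = ratfun_eval q' a b * (Gamma (a / 2) * rGamma (a / 2 - b))"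
      using eq[OF a ab D[folded b_def]] unfolding zero by (simp only: mult_zero_right add_0_right add_0_left)
    moreover have "Gamma (a / 2) \<noteq> 0"
      using half(1)[OF a, of 0] by (metis Gamma_eq_zero_iff nonpos_Ints_Int of_nat_0 add.right_neutral diff_zero)
    moreover have "a / 2 - b = - 1 / 2 - of_nat k" by (simp add: b_def add_divide_distrib)
    then have "rGamma (a / 2 - b) \<noteq> 0"
      using half_notin_nonpos_Ints[of k] by (simp add: rGamma_eq_zero_iff)
    ultimately have ev_eq: "ratfun_eval q a b = ratfun_eval q' a b" by simp
    have "poly2_at id qd a b \<noteq> 0" "poly2_at id qd' a b \<noteq> 0"
      using D unfolding b_def[symmetric] D_def ring_homo_mult[OF ev] by auto
    then have "poly2_at id qn a b * poly2_at id qd' a b = poly2_at id qn' a b * poly2_at id qd a b"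
      using ev_eq by (simp add: ratfun_eval_def ratfun_at_def q q' frac_eq_eq)
    then show "poly2_at id (qn * qd' - qn' * qd) a ((a + 1) / 2 + of_nat k) = 0"
      unfolding b_def[symmetric] ring_homo_diff[OF ev] ring_homo_mult[OF ev] by simp
  qed
  then have "Fract qn qd = Fract qn' qd'" using nz by (simp add: eq_fract)
  then show "q = q'" using Fract_quot_of_fract[of q] Fract_quot_of_fract[of q'] by (simp add: q q')
qed

section \<open>Explicit decompositions\<close>

lemma kummer_factor_altdef:
  "kummer_factor s a b = Gamma (a - b) * Gamma s / (Gamma a * Gamma (s - b))"
  unfolding kummer_factor_def rGamma_inverse_Gamma by (simp add: divide_inverse mult_ac)

lemma ring_homo_kummer_num:
  assumes f: "ring_homo f"
  shows "f (kummer_num u v a b n) = kummer_num (f u) (f v) (f a) (f b) n"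
  by (induction u v a b n rule: kummer_num.induct)
     (simp_all add: ring_homo_simps[OF f] ring_homo_1[OF f])

text \<open>Each step multiplies the coefficient of the top power of the variable by -2, because the
  other term of the recurrence has lower degree. Starting from \<open>e\<close>, it stays nonzero
  whatever \<open>b\<close> is.\<close>

lemma kummer_num_degree:
  fixes b c d e :: complex and u v :: "complex poly"
  defines "q \<equiv> kummer_num u v [:0, 1:] [:b:]"
  assumes u: "u = [:c:]" and v: "v = [:d, e:]" and e: "e \<noteq> 0"
  shows "coeff (q (Suc n)) (Suc n) \<noteq> 0"
proof -
  have "(\<forall>k>n. coeff (q n) k = 0) \<and> coeff (q (Suc n)) (Suc n) \<noteq> 0 \<and> (\<forall>k>Suc n. coeff (q (Suc n)) k = 0)"
  proof (induction n)
    case 0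
    show ?case
      using e by (auto simp: q_def u v coeff_pCons split: nat.splits)
  next
    case (Suc n)
    have q: "q (Suc (Suc n)) = [:3 * (of_nat n + 2), -2:] * q (Suc n)
        + [:- 2 * (of_nat n + 2) * (of_nat n + 1 - b), 2 * (of_nat n + 1 - b):] * q n"
    proof -
      have "3 * (of_nat n + 2) - 2 * [:0, 1:] = [:3 * (of_nat n + 2), -2:: complex:]"
        "2 * ([:0, 1:] - of_nat n - 2) * (of_nat n + 1 - [:b:])
           = [:- 2 * (of_nat n + 2) * (of_nat n + 1 - b), 2 * (of_nat n + 1 - b):]"
        by (simp_all add: of_nat_poly numeral_poly one_pCons algebra_simps del: pCons_one)
      then show ?thesis by (simp add: q_def)
    qed
    have cf: "coeff ([:x, y:] * p) (Suc k) = x * coeff p (Suc k) + y * coeff p k" for x y :: complex and p k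
      by simp
    have "coeff (q (Suc (Suc n))) (Suc k) = 0" if "Suc k > Suc (Suc n)" for k
      unfolding q coeff_add cf using Suc that by simp
    then have "\<forall>k>Suc (Suc n). coeff (q (Suc (Suc n))) k = 0"
      by (metis Suc_lessE)
    moreover have "coeff (q (Suc (Suc n))) (Suc (Suc n)) = - 2 * coeff (q (Suc n)) (Suc n)"
      unfolding q coeff_add cf using Suc by simp
    ultimately show ?case using Suc by simp
  qed
  then show ?thesis by blast
qed

lemma poly2_at_id: "poly2_at id p x y = poly (poly p [:y:]) x"
  unfolding poly2_at_def
  by (induction p) (simp_all add: map_poly_pCons)

lemma ring_homo_poly: "ring_homo (\<lambda>p. poly p x)"
  by (simp add: ring_homo_def)

lemma ring_homo_pCons_const: "ring_homo (\<lambda>c. [:c:])"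
  by (simp add: ring_homo_def pCons_one)

definition kummer_down_P :: "nat \<Rightarrow> ratfun" where
  "kummer_down_P n = Fract (kummer_num 1 (2 - poly_a) poly_a poly_b n) (pochhammer (1 - poly_b) n)"

definition kummer_down_Q :: "nat \<Rightarrow> ratfun" where
  "kummer_down_Q n = Fract (kummer_num 0 (poly_a - 1) poly_a poly_b n) (pochhammer (1 - poly_b) n)"

text \<open>The shifted generators place the fraction at \<open>(a, b)\<close> itself; substituting
  \<open>(a - 2 n, b - n)\<close> restores the numerator of \<open>kummer_down_P n\<close>.\<close>

definition kummer_up_P :: "nat \<Rightarrow> ratfun" where
  "kummer_up_P n = (let a = poly_a + 2 * of_nat n; b = poly_b + of_nat n in
     Fract (kummer_num 1 (2 - a) a b n) ((-4) ^ n * pochhammer (poly_const (1/2) * poly_a) n))"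

definition kummer_up_Q :: "nat \<Rightarrow> ratfun" where
  "kummer_up_Q n = (let a = poly_a + 2 * of_nat n; b = poly_b + of_nat n in
     Fract (kummer_num 0 (a - 1) a b n) (- ((-4) ^ n * pochhammer (poly_const (1/2) * (poly_a + 1)) n)))"

lemma poly2_at_simps:
  assumes h: "ring_homo h"
  shows "poly2_at h (kummer_num u v p q n) x y = kummer_num (poly2_at h u x y) (poly2_at h v x y) (poly2_at h p x y) (poly2_at h q x y) n"
    "poly2_at h 0 x y = 0" "poly2_at h 1 x y = 1"
    "poly2_at h (p + q) x y = poly2_at h p x y + poly2_at h q x y"
    "poly2_at h (p * q) x y = poly2_at h p x y * poly2_at h q x y"
    "poly2_at h (- p) x y = - poly2_at h p x y"
    "poly2_at h (p - q) x y = poly2_at h p x y - poly2_at h q x y"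
    "poly2_at h (of_nat n) x y = of_nat n"
    "poly2_at h (numeral k) x y = numeral k"
    "poly2_at h (p ^ n) x y = poly2_at h p x y ^ n"
    "poly2_at h (pochhammer p n) x y = pochhammer (poly2_at h p x y) n"
    "poly2_at h poly_a x y = x" "poly2_at h poly_b x y = y" "poly2_at h (poly_const c) x y = h c"
proof -
  note ev = ring_homo_poly2_at[OF h, of x y]
  show "poly2_at h (kummer_num u v p q n) x y = kummer_num (poly2_at h u x y) (poly2_at h v x y) (poly2_at h p x y) (poly2_at h q x y) n"
    by (rule ring_homo_kummer_num[OF ev])
  show "poly2_at h 0 x y = 0" by (rule ring_homo_0[OF ev])
  show "poly2_at h 1 x y = 1" by (rule ring_homo_1[OF ev])
  show "poly2_at h (p + q) x y = poly2_at h p x y + poly2_at h q x y" by (rule ring_homo_add[OF ev])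
  show "poly2_at h (p * q) x y = poly2_at h p x y * poly2_at h q x y" by (rule ring_homo_mult[OF ev])
  show "poly2_at h (- p) x y = - poly2_at h p x y" by (rule ring_homo_uminus[OF ev])
  show "poly2_at h (p - q) x y = poly2_at h p x y - poly2_at h q x y" by (rule ring_homo_diff[OF ev])
  show "poly2_at h (of_nat n) x y = of_nat n" by (rule ring_homo_of_nat[OF ev])
  show "poly2_at h (numeral k) x y = numeral k" by (rule ring_homo_numeral[OF ev])
  show "poly2_at h (p ^ n) x y = poly2_at h p x y ^ n" by (rule ring_homo_power[OF ev])
  show "poly2_at h (pochhammer p n) x y = pochhammer (poly2_at h p x y) n" by (rule ring_homo_pochhammer[OF ev])
qed (rule poly2_at_generators[OF h])+

lemmas poly2_at_id_simps = poly2_at_simps[OF ring_homo_id]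

text \<open>
  The numerator has degree \<open>n\<close> in \<open>a\<close> with a constant leading coefficient, so no factor of the
  denominator, a polynomial in \<open>b\<close>, can cancel.
\<close>

lemma kummer_down_P_regular_imp:
  assumes "ratfun_regular (kummer_down_P n) a b"
  shows "pochhammer (1 - b) n \<noteq> 0"
proof
  assume zero: "pochhammer (1 - b) n = 0"
  then obtain m where n: "n = Suc m" by (cases n) auto
  define N where "N = kummer_num 1 (2 - poly_a) poly_a poly_b n"
  define D where "D = pochhammer (1 - poly_b) n"
  have "poly2_at id D 0 0 \<noteq> 0"
    by (simp only: D_def poly2_at_id_simps id_apply; simp flip: pochhammer_fact)
  then have "D \<noteq> 0" using poly2_at_id_simps(2) by metis
  then obtain d where d: "N = fst (quot_of_fract (Fract N D)) * d" "D = snd (quot_of_fract (Fract N D)) * d"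
    by (rule quot_of_fract_Fract)
  define den where "den = snd (quot_of_fract (Fract N D))"
  have "poly2_at id den a b \<noteq> 0"
    using assms by (simp add: ratfun_regular_def kummer_down_P_def N_def D_def den_def)
  \<comment> \<open>Setting the outer variable to \<open>b\<close> gives polynomials in
    \<open>a\<close>: \<open>den\<close> stays nonzero while \<open>D\<close> becomes zero, so the
    cancelled factor \<open>d\<close> vanishes and takes the numerator with it, against its
    degree.\<close>
  then have "poly den [:b:] \<noteq> 0" by (auto simp: poly2_at_id)
  moreover have "poly den [:b:] * poly d [:b:] = poly D [:b:]"
    using d(2) unfolding den_def by (metis poly_mult)
  moreover have "poly D [:b:] = 0"
  proof -
    have "poly D [:b:] = pochhammer (1 - [:b:]) n"
      unfolding D_def ring_homo_pochhammer[OF ring_homo_poly] by simp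
    also have "1 - [:b:] = [:1 - b:]" by (simp add: one_pCons del: pCons_one)
    also have "pochhammer [:1 - b:] n = [:pochhammer (1 - b) n:]"
      using ring_homo_pochhammer[OF ring_homo_pCons_const] by metis
    finally show ?thesis using zero by simp
  qed
  ultimately have "poly d [:b:] = 0" by simp
  then have "poly N [:b:] = 0" using d(1) by (metis poly_mult mult_zero_right)
  moreover have "poly N [:b:] = kummer_num 1 (2 - [:0, 1:]) [:0, 1:] [:b:] n"
    unfolding N_def ring_homo_kummer_num[OF ring_homo_poly] by simp
  moreover have "coeff (kummer_num 1 (2 - [:0, 1:]) [:0, 1:] [:b:] (Suc m)) (Suc m) \<noteq> 0"
    by (rule kummer_num_degree[where c = 1 and d = 2 and e = "-1"]) (simp_all add: one_pCons numeral_poly del: pCons_one)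
  ultimately show False by (simp add: n)
qed

lemma kummer_down_regular:
  assumes "pochhammer (1 - b) n \<noteq> 0"
  shows "ratfun_regular (kummer_down_P n) a b" "ratfun_regular (kummer_down_Q n) a b"
  unfolding ratfun_regular_def kummer_down_P_def kummer_down_Q_def
proof -
  have D: "poly2_at id (pochhammer (1 - poly_b) n) a b \<noteq> 0"
    using assms by (simp only: poly2_at_id_simps id_apply; simp)
  show "poly2_at id (snd (quot_of_fract (Fract (kummer_num 1 (2 - poly_a) poly_a poly_b n) (pochhammer (1 - poly_b) n)))) a b \<noteq> 0"
    "poly2_at id (snd (quot_of_fract (Fract (kummer_num 0 (poly_a - 1) poly_a poly_b n) (pochhammer (1 - poly_b) n)))) a b \<noteq> 0"
    by (rule ratfun_at_Fract(1)[OF ring_homo_id D])+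
qed

text \<open>The decomposition is demanded wherever the reduced fractions are regular; regularity of
  the P coefficient forces \<open>pochhammer (1 - b) n\<close> to be nonzero, which allows division
  in the cleared formula.\<close>

lemma kummer_decomposition_down:
  "kummer_decomposition (- int n - 1) (kummer_down_P n) (kummer_down_Q n)"
  unfolding kummer_decomposition_def
proof (intro allI impI)
  fix a b :: complex
  assume a: "a \<notin> \<int>\<^sub>\<le>\<^sub>0" and ab: "a - b \<notin> \<int>\<^sub>\<le>\<^sub>0" and "ratfun_regular (kummer_down_P n) a b"
  then have nz: "pochhammer (1 - b) n \<noteq> 0" by (intro kummer_down_P_regular_imp)
  then have D: "poly2_at id (pochhammer (1 - poly_b) n) a b \<noteq> 0" by (simp only: poly2_at_id_simps id_apply; simp)
  have P: "ratfun_eval (kummer_down_P n) a b = kummer_num 1 (2 - a) a b n / pochhammer (1 - b) n"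
    unfolding ratfun_eval_def kummer_down_P_def ratfun_at_Fract(2)[OF ring_homo_id D] by (simp only: poly2_at_id_simps id_apply; simp)
  have Q: "ratfun_eval (kummer_down_Q n) a b = kummer_num 0 (a - 1) a b n / pochhammer (1 - b) n"
    unfolding ratfun_eval_def kummer_down_Q_def ratfun_at_Fract(2)[OF ring_homo_id D] by (simp only: poly2_at_id_simps id_apply; simp)
  have E: "a + of_int (- int n - 1) = a - of_nat n - 1" by simp
  have F: "hyp2F1 (a - of_nat n - 1) b (a - b) (-1) =
     kummer_num 1 (2 - a) a b n / pochhammer (1 - b) n * kummer_factor_P a b + kummer_num 0 (a - 1) a b n / pochhammer (1 - b) n * kummer_factor_Q a b"
    using hyp2F1_minus_one_down[OF a ab, of n] nz by (simp add: nonzero_eq_divide_eq add_divide_distrib[symmetric] mult.commute)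
  show "hyp2F1 (a + of_int (- int n - 1)) b (a - b) (-1) =
      ratfun_eval (kummer_down_P n) a b * (Gamma (a - b) * Gamma ((a + 1) / 2) / (Gamma a * Gamma ((a + 1) / 2 - b))) +
      ratfun_eval (kummer_down_Q n) a b * (Gamma (a - b) * Gamma (a / 2) / (Gamma a * Gamma (a / 2 - b)))"
    unfolding P Q E kummer_factor_altdef[symmetric] by (rule F)
qed

text \<open>Here the denominators depend on \<open>a\<close> only and vanish only at nonpositive
  integers, which the decomposition excludes.\<close>

lemma kummer_decomposition_up:
  "kummer_decomposition (int n - 1) (kummer_up_P n) (kummer_up_Q n)"
  unfolding kummer_decomposition_def
proof (intro allI impI)
  fix a b :: complex
  assume a: "a \<notin> \<int>\<^sub>\<le>\<^sub>0" and ab: "a - b \<notin> \<int>\<^sub>\<le>\<^sub>0"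
  define a' b' where "a' = a + 2 * of_nat n" and "b' = b + of_nat n"
  have D: "poly2_at id ((-4) ^ n * pochhammer (poly_const (1/2) * poly_a) n) a b \<noteq> 0"
    "poly2_at id (- ((-4) ^ n * pochhammer (poly_const (1/2) * (poly_a + 1)) n)) a b \<noteq> 0"
    using not_nonpos_Ints_half[OF a] by (simp_all only: poly2_at_id_simps id_apply) (simp_all add: pochhammer_neq_0)
  have P: "ratfun_eval (kummer_up_P n) a b = kummer_num 1 (2 - a') a' b' n / ((-4) ^ n * pochhammer (a / 2) n)"
    unfolding ratfun_eval_def kummer_up_P_def Let_def ratfun_at_Fract(2)[OF ring_homo_id D(1)]
    by (simp only: poly2_at_id_simps id_apply a'_def b'_def; simp)
  have Q: "ratfun_eval (kummer_up_Q n) a b = kummer_num 0 (a' - 1) a' b' n / (- ((-4) ^ n * pochhammer ((a + 1) / 2) n))"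
    unfolding ratfun_eval_def kummer_up_Q_def Let_def ratfun_at_Fract(2)[OF ring_homo_id D(2)]
    by (simp only: poly2_at_id_simps id_apply a'_def b'_def; simp)
  have E: "a + of_int (int n - 1) = a + of_nat n - 1" by simp
  note F = hyp2F1_minus_one_up[OF a ab, of n, folded a'_def b'_def]
  show "hyp2F1 (a + of_int (int n - 1)) b (a - b) (-1) =
      ratfun_eval (kummer_up_P n) a b * (Gamma (a - b) * Gamma ((a + 1) / 2) / (Gamma a * Gamma ((a + 1) / 2 - b))) +
      ratfun_eval (kummer_up_Q n) a b * (Gamma (a - b) * Gamma (a / 2) / (Gamma a * Gamma (a / 2 - b)))"
    unfolding P Q E kummer_factor_altdef[symmetric] by (rule F)
qed

lemma kummer_PQ_eq:
  assumes "kummer_decomposition m p q"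
  shows "kummer_P m = p" "kummer_Q m = q"
proof -
  have "kummer_PQ m = (p, q)"
    unfolding kummer_PQ_def
  proof (rule the_equality)
    show "case (p, q) of (p, q) \<Rightarrow> kummer_decomposition m p q" using assms by simp
  next
    fix x assume "case x of (p, q) \<Rightarrow> kummer_decomposition m p q"
    then show "x = (p, q)"
      using kummer_decomposition_unique[OF _ assms, of "fst x" "snd x"] by (simp add: case_prod_unfold prod_eq_iff)
  qed
  then show "kummer_P m = p" "kummer_Q m = q"
    by (simp_all add: kummer_P_def kummer_Q_def)
qed

section \<open>The symmetry inside the field of rational functions\<close>

lemma ratfun_const_half_mult_2: "ratfun_const (1 / 2) * 2 = 1"
proof -
  have "ratfun_const (1 / 2) * ratfun_const 2 = ratfun_const 1"
    unfolding ring_homo_mult[OF ring_homo_ratfun_const, symmetric] by simp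
  then show ?thesis
    unfolding ring_homo_numeral[OF ring_homo_ratfun_const] ring_homo_1[OF ring_homo_ratfun_const] .
qed

lemma ratfun_two_neq_0: "(2 :: ratfun) \<noteq> 0"
  by (metis ratfun_const_half_mult_2 mult_zero_right zero_neq_one)

lemma ratfun_const_half: "ratfun_const (1 / 2) * x = x / 2"
proof -
  have "ratfun_const (1 / 2) * x * 2 = x"
    using ratfun_const_half_mult_2 by (metis mult.assoc mult.commute mult_1_right)
  then show ?thesis
    using ratfun_two_neq_0 by (metis nonzero_eq_divide_eq)
qed

text \<open>Reversal of Pochhammer symbols: \<open>a/2 - n, ..., a/2 - 1\<close> are the negatives
  of the factors of \<open>pochhammer (1 - a/2) n\<close>, and the resulting sign cancels that of
  \<open>(-4)^n\<close>; likewise for the factors starting at \<open>(a + 1)/2 - n\<close>.\<close>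

lemma ratfun_up_denominators:
  fixes n :: nat
  defines "x \<equiv> ratfun_a - 2 * of_nat n"
  shows "(-4) ^ n * pochhammer (ratfun_const (1 / 2) * x) n = 2 ^ (2 * n) * pochhammer (1 - ratfun_a / 2) n"
    and "(-4) ^ n * pochhammer (ratfun_const (1 / 2) * (x + 1)) n = 2 ^ (2 * n) * pochhammer ((1 - ratfun_a) / 2) n"
    and "(-4) ^ n * pochhammer (ratfun_const (1 / 2) * x) n \<noteq> 0"
    and "(-4) ^ n * pochhammer (ratfun_const (1 / 2) * (x + 1)) n \<noteq> 0"
proof -
  have half_nat: "(2 * of_nat n :: ratfun) / 2 = of_nat n"
    using ratfun_two_neq_0 by simp
  have four: "(-4) ^ n = (2 ^ (2 * n) * (-1) ^ n :: ratfun)"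
    unfolding power_mult by (simp flip: power_mult_distrib)
  have "ratfun_const (1 / 2) * x = (ratfun_a / 2 - 1) - of_nat n + 1"
    unfolding x_def ratfun_const_half diff_divide_distrib half_nat by simp
  then show "(-4) ^ n * pochhammer (ratfun_const (1 / 2) * x) n = 2 ^ (2 * n) * pochhammer (1 - ratfun_a / 2) n"
    using pochhammer_minus[of "ratfun_a / 2 - 1" n] unfolding four by simp
  have "(2 :: ratfun) / 2 = 1" using ratfun_two_neq_0 by simp
  then have "(ratfun_a + 1) / 2 = (ratfun_a - 1) / 2 + 1"
    by (metis (no_types) add_divide_distrib diff_add_eq one_add_one add_diff_cancel_right' add.assoc diff_add_cancel)
  then have Q1: "ratfun_const (1 / 2) * (x + 1) = (ratfun_a - 1) / 2 - of_nat n + 1"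
    unfolding x_def ratfun_const_half diff_add_eq[symmetric] diff_divide_distrib half_nat
    by (simp add: ratfun_two_neq_0 diff_divide_distrib half_nat algebra_simps)
  have Q2: "(1 - ratfun_a) / 2 = - ((ratfun_a - 1) / 2)"
    by (metis minus_diff_eq minus_divide_left)
  show "(-4) ^ n * pochhammer (ratfun_const (1 / 2) * (x + 1)) n = 2 ^ (2 * n) * pochhammer ((1 - ratfun_a) / 2) n"
    unfolding Q1 Q2 pochhammer_minus four by (simp only: mult.assoc)
  \<comment> \<open>Evaluation at \<open>a = 1\<close> for \<open>p\<close> and at
    \<open>a = 0\<close> for \<open>q\<close> shows nonvanishing: both Pochhammer symbols then start
    at the half-integer \<open>1/2 - n\<close> and so contain no zero factor.\<close>
  have nz: "pochhammer (1 / 2 - of_nat n) n \<noteq> (0 :: complex)"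
    by (intro pochhammer_neq_0 half_notin_nonpos_Ints)
  define p q where "p = (-4) ^ n * pochhammer (poly_const (1 / 2) * (poly_a - 2 * of_nat n)) n"
    and "q = (-4) ^ n * pochhammer (poly_const (1 / 2) * (poly_a - 2 * of_nat n + 1)) n"
  have e: "(1 / 2 :: complex) * (1 - 2 * of_nat n) = 1 / 2 - of_nat n" "(1 / 2 :: complex) * (0 - 2 * of_nat n + 1) = 1 / 2 - of_nat n"
    by (simp_all add: diff_divide_distrib)
  have "poly2_at id p 1 0 \<noteq> 0" "poly2_at id q 0 0 \<noteq> 0"
    unfolding p_def q_def poly2_at_id_simps id_apply e using nz by simp_all
  then have p: "p \<noteq> 0" and q: "q \<noteq> 0"
    using poly2_at_simps(2)[OF ring_homo_id] by (blast, blast)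
  note to_fract_homo = ring_homo_simps[OF ring_homo_to_fract] ring_homo_1[OF ring_homo_to_fract]
  have "(-4) ^ n * pochhammer (ratfun_const (1 / 2) * x) n = to_fract p"
    unfolding p_def x_def ratfun_a_def ratfun_const_def to_fract_homo ..
  then show "(-4) ^ n * pochhammer (ratfun_const (1 / 2) * x) n \<noteq> 0"
    using p by (simp only: to_fract_eq_0_iff not_False_eq_True)
  have "(-4) ^ n * pochhammer (ratfun_const (1 / 2) * (x + 1)) n = to_fract q"
    unfolding q_def x_def ratfun_a_def ratfun_const_def to_fract_homo ..
  then show "(-4) ^ n * pochhammer (ratfun_const (1 / 2) * (x + 1)) n \<noteq> 0"
    using q by (simp only: to_fract_eq_0_iff not_False_eq_True)
qed

lemma kummer_down_conv:
  "kummer_down_P n = kummer_num 1 (2 - ratfun_a) ratfun_a ratfun_b n / pochhammer (1 - ratfun_b) n"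
  "kummer_down_Q n = kummer_num 0 (ratfun_a - 1) ratfun_a ratfun_b n / pochhammer (1 - ratfun_b) n"
  unfolding kummer_down_P_def kummer_down_Q_def Fract_conv_to_fract ratfun_a_def ratfun_b_def
    ring_homo_kummer_num[OF ring_homo_to_fract] ring_homo_simps[OF ring_homo_to_fract]
  by simp_all

lemma ratfun_subst_kummer_up:
  fixes n :: nat
  defines "x \<equiv> ratfun_a - 2 * of_nat n" and "y \<equiv> ratfun_b - of_nat n"
  shows "ratfun_subst (kummer_up_P n) x y =
      kummer_num 1 (2 - ratfun_a) ratfun_a ratfun_b n / (2 ^ (2 * n) * pochhammer (1 - ratfun_a / 2) n)"
    and "ratfun_subst (kummer_up_Q n) x y =
      kummer_num 0 (ratfun_a - 1) ratfun_a ratfun_b n / (- (2 ^ (2 * n) * pochhammer ((1 - ratfun_a) / 2) n))"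
proof -
  note ev = poly2_at_simps[OF ring_homo_ratfun_const]
  have D: "poly2_at ratfun_const ((-4) ^ n * pochhammer (poly_const (1 / 2) * poly_a) n) x y = 2 ^ (2 * n) * pochhammer (1 - ratfun_a / 2) n"
    unfolding ev x_def by (rule ratfun_up_denominators)
  have D': "poly2_at ratfun_const (- ((-4) ^ n * pochhammer (poly_const (1 / 2) * (poly_a + 1)) n)) x y = - (2 ^ (2 * n) * pochhammer ((1 - ratfun_a) / 2) n)"
    unfolding ev x_def ratfun_up_denominators(2) ..
  have nz: "poly2_at ratfun_const ((-4) ^ n * pochhammer (poly_const (1 / 2) * poly_a) n) x y \<noteq> 0"
    unfolding D ratfun_up_denominators(1)[symmetric] by (rule ratfun_up_denominators)
  have nz': "poly2_at ratfun_const (- ((-4) ^ n * pochhammer (poly_const (1 / 2) * (poly_a + 1)) n)) x y \<noteq> 0"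
    unfolding D' ratfun_up_denominators(2)[symmetric] neg_equal_0_iff_equal by (rule ratfun_up_denominators)
  have xy: "x + 2 * of_nat n = ratfun_a" "y + of_nat n = ratfun_b" by (simp_all add: x_def y_def)
  show "ratfun_subst (kummer_up_P n) x y =
      kummer_num 1 (2 - ratfun_a) ratfun_a ratfun_b n / (2 ^ (2 * n) * pochhammer (1 - ratfun_a / 2) n)"
    unfolding ratfun_subst_def kummer_up_P_def Let_def ratfun_at_Fract(2)[OF ring_homo_ratfun_const nz] D
    unfolding ev xy ..
  show "ratfun_subst (kummer_up_Q n) x y =
      kummer_num 0 (ratfun_a - 1) ratfun_a ratfun_b n / (- (2 ^ (2 * n) * pochhammer ((1 - ratfun_a) / 2) n))"
    unfolding ratfun_subst_def kummer_up_Q_def Let_def ratfun_at_Fract(2)[OF ring_homo_ratfun_const nz'] D'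
    unfolding ev xy ..
qed

theorem theorem3:
  fixes n :: nat and a b :: complex
  assumes "a \<notin> of_nat ` {0..n}" and "b \<notin> of_nat ` {0..n}"
  shows "ratfun_eq_at (kummer_P (- int n - 1))
           (2 ^ (2 * n) * (pochhammer (1 - ratfun_a / 2) n / pochhammer (1 - ratfun_b) n)
              * ratfun_subst (kummer_P (int n - 1)) (ratfun_a - 2 * of_nat n) (ratfun_b - of_nat n))
           a b
       \<and> ratfun_eq_at (kummer_Q (- int n - 1))
           (- (2 ^ (2 * n)) * (pochhammer ((1 - ratfun_a) / 2) n / pochhammer (1 - ratfun_b) n)
              * ratfun_subst (kummer_Q (int n - 1)) (ratfun_a - 2 * of_nat n) (ratfun_b - of_nat n))
           a b"
proof -
  \<comment> \<open>The zeros in \<open>b\<close> are \<open>1, ..., n\<close>; away from them both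
    \<open>kummer_down\<close> fractions are regular at \<open>(a, b)\<close>.\<close>
  have "pochhammer (1 - b) n \<noteq> 0"
  proof
    assume "pochhammer (1 - b) n = 0"
    then obtain k where k: "k < n" "1 - b = - of_nat k"
      by (auto simp: pochhammer_eq_0_iff)
    then have "b = of_nat (Suc k)" by (simp add: algebra_simps)
    moreover have "Suc k \<in> {0..n}" using k(1) by simp
    ultimately show False using assms(2) by blast
  qed
  note reg = kummer_down_regular[OF this, of a]
  \<comment> \<open>An equation in the field: both sides are the same reduced fraction, so
    regularity and equality of the values at \<open>(a, b)\<close> follow together.\<close>
  have "2 ^ (2 * n) * (pochhammer (1 - ratfun_a / 2) n / pochhammer (1 - ratfun_b) n)
      * ratfun_subst (kummer_up_P n) (ratfun_a - 2 * of_nat n) (ratfun_b - of_nat n) = kummer_down_P n"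
    unfolding ratfun_subst_kummer_up kummer_down_conv
    using ratfun_up_denominators(3)[of n] unfolding ratfun_up_denominators(1) by simp
  moreover have "- (2 ^ (2 * n)) * (pochhammer ((1 - ratfun_a) / 2) n / pochhammer (1 - ratfun_b) n)
      * ratfun_subst (kummer_up_Q n) (ratfun_a - 2 * of_nat n) (ratfun_b - of_nat n) = kummer_down_Q n"
    unfolding ratfun_subst_kummer_up kummer_down_conv
    using ratfun_up_denominators(4)[of n] unfolding ratfun_up_denominators(2) by simp
  ultimately show ?thesis
    unfolding kummer_PQ_eq[OF kummer_decomposition_down] kummer_PQ_eq[OF kummer_decomposition_up]
    using reg by (simp add: ratfun_eq_at_def)
qed

end
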